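(* Let $p$ be any prime and $t\ge1$. Let $v_1,\dots,v_t:\mathcal{B}([0,1])\to\mathbb{R}$ be functions such that for each $1\le j\le t$: for all $\varepsilon>0$ there exists $\delta>0$ such that $|v_j(A)-v_j(B)|\le\varepsilon$ for all $A,B\in\mathcal{B}([0,1])$ with $\lambda(A\triangle B)\le\delta$. Then there exists a consensus-$1/p$-division: it is possible to partition $[0,1]$ into $p$ (not necessarily connected) pieces $A_1,\dots,A_p$ using at most $(p-1)t$ cuts such that $v_j(A_i)=v_j(A_\ell)$ for all $1\le i,\ell\le p$ and $1\le j\le t$.
   Context: $\mathcal{B}([0,1])$ is the Borel $\sigma$-algebra on $[0,1]$, $\lambda$ is Lebesgue measure on $[0,1]$, and $A\triangle B=(A\setminus B)\cup(B\setminus A)$. The functions $v_j$ need not be additive nor non-negative. Partitioning using at most $(p-1)t$ cuts means choosing at most $(p-1)t$ points of $[0,1]$, which split it into intervals, and assigning each interval to one of the $p$ pieces. *)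

theory Defs
  imports "HOL-Analysis.Analysis" "HOL-Computational_Algebra.Primes"
begin

definition borel_01 :: "real set set" where
  "borel_01 = sets (restrict_space borel {0..1})"

definition lambda_01 :: "real measure" where
  "lambda_01 = restrict_space lborel {0..1}"

definition symm_diff_continuous :: "(real set \<Rightarrow> real) \<Rightarrow> bool" where
  "symm_diff_continuous v \<longleftrightarrow>
     (\<forall>\<epsilon>>0. \<exists>\<delta>>0. \<forall>A\<in>borel_01. \<forall>B\<in>borel_01.
        measure lambda_01 ((A - B) \<union> (B - A)) \<le> \<delta> \<longrightarrow> \<bar>v A - v B\<bar> \<le> \<epsilon>)"

text \<open>The cut points \<open>xs\<close> are listed in increasing order and split \<open>[0,1]\<close> into
  \<open>length xs + 1\<close> intervals, numbered from \<open>0\<close>. By convention a cut point belongs to the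
  interval on its right, so that the intervals are pairwise disjoint and cover \<open>[0,1]\<close>. The first
  interval is empty if \<open>0\<close> is a cut point.\<close>

definition cut_interval :: "real list \<Rightarrow> nat \<Rightarrow> real set" where
  "cut_interval xs k =
     (let ys = 0 # xs @ [1]
      in if k < length xs then {ys ! k ..< ys ! Suc k} else {ys ! k .. ys ! Suc k})"

definition partition_using_cuts :: "nat \<Rightarrow> nat \<Rightarrow> (nat \<Rightarrow> real set) \<Rightarrow> bool" where
  "partition_using_cuts m p A \<longleftrightarrow>
     (\<Union>i\<in>{1..p}. A i) = {0..1} \<and> disjoint_family_on A {1..p} \<and>
     (\<exists>xs f. sorted_wrt (<) xs \<and> set xs \<subseteq> {0..1} \<and> length xs \<le> m \<and>
        f \<in> {..length xs} \<rightarrow> {1..p} \<and>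
        (\<forall>i\<in>{1..p}. A i = (\<Union>k\<in>{k. k \<le> length xs \<and> f k = i}. cut_interval xs k)))"

end

theory Submission
  imports Defs "HOL-Homology.Simplices" "HOL-Number_Theory.Cong"
begin

text \<open>A choice of \<open>n = (p - 1) t\<close> cuts together with an assignment of the intervals to the \<open>p\<close> pieces is a point of the
  join of \<open>n + 1\<close> copies of the group of order \<open>p\<close>. The deviations of the values \<open>v\<^sub>j(A\<^sub>i)\<close> from their mean over \<open>i\<close>
  form an equivariant map on it. If this map had no zero, labelling each point with a pair \<open>(i, j)\<close> of maximal deviation
  would turn every sufficiently fine subdivision of the join into an equivariant simplicial map to the complex of those
  sets of pairs that contain no full block \<open>{(1, j), \<dots>, (p, j)}\<close>; its dimension is \<open>n - 1\<close> and, as \<open>p\<close> is prime, the group acts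
  freely on it. In the join there are chains \<open>h\<^sub>0, \<dots>, h\<^sub>n\<close> such that \<open>h\<^sub>0\<close> is a vertex and the boundary of \<open>h\<^sub>k\<^sub>+\<^sub>1\<close> is
  \<open>(\<nu> - 1) h\<^sub>k\<close> for even \<open>k\<close> and \<open>(1 + \<nu> + \<dots> + \<nu>\<^bsup>p-1\<^esup>) h\<^sub>k\<close> for odd \<open>k\<close>. The image of \<open>h\<^sub>n\<close> vanishes for dimension
  reasons, and descending along the chain with the help of freeness shows that the number of points of \<open>h\<^sub>0\<close>, which
  is \<open>1\<close>, is divisible by \<open>p\<close>.\<close>

section \<open>Rotation of blocks\<close>

text \<open>The number \<open>j * p + i\<close> with \<open>i < p\<close> encodes position
  \<open>i\<close> of block \<open>j\<close>, both for labels and for coordinates of the join.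
  Rotating all blocks at once is the action of a generator \<nu> of the cyclic group of order
  \<open>p\<close>.\<close>

definition rot :: "nat \<Rightarrow> nat \<Rightarrow> nat" where
  "rot p m = m div p * p + (m mod p + 1) mod p"

lemma rot_div [simp]: "p > 0 \<Longrightarrow> rot p m div p = m div p"
  by (simp add: rot_def)

lemma rot_mod [simp]: "rot p m mod p = (m mod p + 1) mod p"
  by (simp add: rot_def)

lemma funpow_rot: "p > 0 \<Longrightarrow> (rot p ^^ i) m = m div p * p + (m mod p + i) mod p"
  by (induction i) (auto simp: rot_def mod_Suc_eq)

lemma funpow_rot_period [simp]: "p > 0 \<Longrightarrow> rot p ^^ p = id"
  by (rule ext) (simp add: funpow_rot)

lemma rot_block: "i < p \<Longrightarrow> rot p (j * p + i) = j * p + Suc i mod p"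
  by (simp add: rot_def)

lemma inj_rot: assumes "p > 0" shows "inj (rot p)"
proof -
  have "inj (rot p ^^ p)"
    using assms by simp
  then have "inj (rot p ^^ (p - 1) \<circ> rot p)"
    using assms by (metis Suc_pred' funpow_Suc_right)
  then show ?thesis
    by (rule inj_on_imageI2)
qed

lemma bij_betw_rot_lessThan: assumes "p > 0" shows "bij_betw (rot p) {..<k * p} {..<k * p}"
proof -
  have "rot p ` {..<k * p} \<subseteq> {..<k * p}"
  proof clarsimp
    fix m assume "m < k * p"
    then show "rot p m < k * p"
      using assms rot_div by (metis less_mult_imp_div_less div_less_iff_less_mult)
  qed
  moreover have "inj_on (rot p) {..<k * p}"
    using inj_rot[OF assms] inj_on_subset by blast
  ultimately show ?thesis
    by (simp add: bij_betw_def endo_inj_surj)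
qed

lemma rot_less_iff [simp]: "p > 0 \<Longrightarrow> rot p m < k * p \<longleftrightarrow> m < k * p"
  by (metis div_less_iff_less_mult rot_div)

lemma sum_rot: "p > 0 \<Longrightarrow> (\<Sum>m<k * p. f (rot p m)) = (\<Sum>m<k * p. f m)"
  by (rule sum.reindex_bij_betw[OF bij_betw_rot_lessThan])

section \<open>The target complex and equivariant choices on it\<close>

text \<open>These are the simplices of the join of \<open>t\<close> copies of the boundary of a
  simplex with \<open>p\<close> vertices.\<close>

definition blockwise_proper :: "nat \<Rightarrow> nat \<Rightarrow> nat set \<Rightarrow> bool" where
  "blockwise_proper p t S \<longleftrightarrow> S \<noteq> {} \<and> S \<subseteq> {..<t * p} \<and> (\<forall>j<t. \<exists>i<p. j * p + i \<notin> S)"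

lemma blockwise_proper_subset:
  "blockwise_proper p t S \<Longrightarrow> T \<subseteq> S \<Longrightarrow> T \<noteq> {} \<Longrightarrow> blockwise_proper p t T"
  unfolding blockwise_proper_def by blast

lemma blockwise_proper_rot:
  assumes "p > 0"
  shows "blockwise_proper p t (rot p ` S) \<longleftrightarrow> blockwise_proper p t S"
proof -
  have 1: "rot p ` S \<subseteq> {..<t * p} \<longleftrightarrow> S \<subseteq> {..<t * p}"
    using assms by auto
  have surj: "\<exists>k<p. i = Suc k mod p" if "i < p" for i
    using that by (intro exI[of _ "if i = 0 then p - 1 else i - 1"]) auto
  have 2: "(\<exists>i<p. j * p + i \<notin> rot p ` S) \<longleftrightarrow> (\<exists>i<p. j * p + i \<notin> S)" for j
  proof -
    have eq: "j * p + Suc i mod p \<in> rot p ` S \<longleftrightarrow> j * p + i \<in> S" if "i < p" for i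
      using inj_image_mem_iff[OF inj_rot[OF assms], of "j * p + i" S] rot_block[OF that] by simp
    show ?thesis
      using surj eq by (metis assms mod_less_divisor)
  qed
  show ?thesis
    unfolding blockwise_proper_def 1 2 by simp
qed

lemma card_block:
  assumes "blockwise_proper p t S" "j < t"
  shows "card {m \<in> S. m div p = j} < p"
proof -
  obtain i where i: "i < p" "j * p + i \<notin> S"
    using assms unfolding blockwise_proper_def by blast
  have "{m \<in> S. m div p = j} \<subseteq> (\<lambda>i. j * p + i) ` ({..<p} - {i})"
  proof clarsimp
    fix m assume m: "m \<in> S" "j = m div p"
    then have "m = j * p + m mod p" "m mod p < p" "m mod p \<noteq> i"
      using i by auto
    then show "m \<in> (\<lambda>i. m div p * p + i) ` ({..<p} - {i})"
      using m by blast
  qed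
  then have "card {m \<in> S. m div p = j} \<le> card ({..<p} - {i})"
    by (meson card_image_le card_mono finite_Diff finite_imageI finite_lessThan le_trans)
  then show ?thesis
    using i by simp
qed

text \<open>Each of the \<open>t\<close> blocks contributes at most \<open>p - 1\<close> elements.
  This dimension bound kills the label chain in degree \<open>t * (p - 1)\<close>.\<close>

lemma card_blockwise_proper:
  assumes "blockwise_proper p t S"
  shows "card S \<le> t * (p - 1)"
proof -
  define b where "b j = {m \<in> S. m div p = j}" for j
  have p: "p > 0"
    using assms unfolding blockwise_proper_def by (cases p) auto
  have S: "S \<subseteq> {..<t * p}"
    using assms unfolding blockwise_proper_def by auto
  have "S = (\<Union>j<t. b j)"
    using S p by (auto simp: b_def div_less_iff_less_mult)
  then have "card S \<le> (\<Sum>j<t. card (b j))"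
    using card_UN_le[of "{..<t}" b] by simp
  also have "\<dots> \<le> (\<Sum>j<t. p - 1)"
  proof (rule sum_mono)
    fix j assume "j \<in> {..<t}"
    then show "card (b j) \<le> p - 1"
      using card_block[OF assms] by (fastforce simp: b_def)
  qed
  finally show ?thesis
    by simp
qed

text \<open>The first nonempty block of \<open>S\<close> has \<open>c\<close> elements with \<open>0 < c < p\<close>, so \<open>c\<close> is invertible
  modulo \<open>p\<close>; rotating adds \<open>c\<close> to the sum of the positions in that block.\<close>

lemma equivariant_index_exists:
  assumes "prime p"
  obtains r :: "nat set \<Rightarrow> nat" where
    "\<And>S. blockwise_proper p t S \<Longrightarrow> r S < p"
    "\<And>S. blockwise_proper p t S \<Longrightarrow> r (rot p ` S) = Suc (r S) mod p"
proof -
  have p: "p > 0"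
    using assms prime_gt_0_nat by auto
  define j where "j S = Min ((\<lambda>m. m div p) ` S)" for S :: "nat set"
  define b where "b S = {m \<in> S. m div p = j S}" for S
  define w where "w c = (SOME a. [c * a = 1] (mod p))" for c
  define r where "r S = w (card (b S)) * (\<Sum>m\<in>b S. m mod p) mod p" for S
  have r: "r (rot p ` S) = Suc (r S) mod p" if "blockwise_proper p t S" for S
  proof -
    have S: "S \<noteq> {}" "S \<subseteq> {..<t * p}"
      using that unfolding blockwise_proper_def by auto
    have fin: "finite S"
      using S finite_subset by blast
    have "j (rot p ` S) = j S"
      using p by (simp add: j_def image_image)
    then have b: "b (rot p ` S) = rot p ` b S"
      using p by (auto simp: b_def)
    have inj: "inj_on (rot p) (b S)"
      using inj_rot[OF p] inj_on_subset by blast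
    have finb: "finite (b S)"
      using fin by (simp add: b_def)
    have "j S \<in> (\<lambda>m. m div p) ` S"
      unfolding j_def using S fin by (intro Min_in) auto
    then obtain m where m: "m \<in> S" "m div p = j S"
      by auto
    have "b S \<noteq> {}"
      using m by (auto simp: b_def)
    then have c0: "card (b S) > 0"
      using finb by (simp add: card_gt_0_iff)
    have "j S < t"
      using m S p by (metis div_less_iff_less_mult lessThan_iff subsetD)
    then have "card (b S) < p"
      using card_block[OF that] by (simp add: b_def)
    then have "coprime (card (b S)) p"
      using c0 assms by (metis coprime_commute nat_dvd_not_less prime_imp_coprime_nat)
    then have "\<exists>a. [card (b S) * a = 1] (mod p)"
      using cong_solve_coprime_nat by simp
    then have w: "[card (b S) * w (card (b S)) = 1] (mod p)"
      unfolding w_def by (rule someI_ex)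
    have "[(\<Sum>m\<in>b S. (m mod p + 1) mod p) = (\<Sum>m\<in>b S. m mod p + 1)] (mod p)"
      by (rule cong_sum) (simp add: cong_def)
    then have "[(\<Sum>m\<in>rot p ` b S. m mod p) = (\<Sum>m\<in>b S. m mod p) + card (b S)] (mod p)"
      by (simp add: sum.reindex[OF inj] sum_Suc)
    then have "[w (card (b S)) * (\<Sum>m\<in>rot p ` b S. m mod p)
        = w (card (b S)) * ((\<Sum>m\<in>b S. m mod p) + card (b S))] (mod p)"
      using cong_mult cong_refl by blast
    also have "[w (card (b S)) * ((\<Sum>m\<in>b S. m mod p) + card (b S))
        = w (card (b S)) * (\<Sum>m\<in>b S. m mod p) + 1] (mod p)"
      using w by (simp only: distrib_left cong_add_lcancel_nat mult.commute[of "card (b S)"])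
    finally show ?thesis
      using card_image[OF inj] by (simp add: r_def b cong_def mod_Suc_eq)
  qed
  show thesis
    by (rule that[of r]) (use r p in \<open>simp_all add: r_def\<close>)
qed

text \<open>The set \<open>S\<close> rotated back by its equivariant index, \<open>N S\<close>, is
  the same for all rotations of \<open>S\<close>. Its least element, rotated forward again, is
  therefore an equivariant choice from \<open>S\<close>.\<close>

lemma equivariant_selection_exists:
  assumes "prime p"
  obtains sel :: "nat set \<Rightarrow> nat" where
    "\<And>S. blockwise_proper p t S \<Longrightarrow> sel S \<in> S"
    "\<And>S. blockwise_proper p t S \<Longrightarrow> sel (rot p ` S) = rot p (sel S)"
proof -
  have p: "p > 0"
    using assms prime_gt_0_nat by auto
  obtain r where r: "\<And>S. blockwise_proper p t S \<Longrightarrow> r S < p"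
    "\<And>S. blockwise_proper p t S \<Longrightarrow> r (rot p ` S) = Suc (r S) mod p"
    using equivariant_index_exists[OF assms] by blast
  define N where "N S = (rot p ^^ (p - r S)) ` S" for S
  define sel where "sel S = (rot p ^^ r S) (Min (N S))" for S
  have N: "(rot p ^^ r S) ` N S = S" if "blockwise_proper p t S" for S
  proof -
    have "rot p ^^ r S \<circ> rot p ^^ (p - r S) = id"
      using r(1)[OF that] p by (simp flip: funpow_add)
    then show ?thesis
      by (simp add: N_def image_comp)
  qed
  show thesis
  proof
    fix S assume S: "blockwise_proper p t S"
    have "finite S" "S \<noteq> {}"
      using S finite_subset unfolding blockwise_proper_def by auto
    then have "Min (N S) \<in> N S"
      by (intro Min_in) (auto simp: N_def)
    then show "sel S \<in> S"
      using N[OF S] by (auto simp: sel_def)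
    show "sel (rot p ` S) = rot p (sel S)"
    proof (cases "Suc (r S) = p")
      case True
      \<comment> \<open>The index of the rotated set wraps round to 0, so its exponent is
        \<open>p - 0\<close>, a full turn.\<close>
      then have "rot p ^^ (p - 0) \<circ> rot p = rot p ^^ (p - r S)"
        using p by auto
      then have "N (rot p ` S) = N S"
        using r(2)[OF S] True p by (simp add: N_def image_comp)
      moreover have "rot p ((rot p ^^ r S) x) = x" for x
        using True p by (metis comp_apply funpow.simps(2) funpow_rot_period id_apply)
      ultimately show ?thesis
        using r(2)[OF S] True by (simp add: sel_def)
    next
      case False
      then have *: "Suc (r S) < p"
        using r(1)[OF S] by simp
      then have "rot p ^^ (p - Suc (r S)) \<circ> rot p = rot p ^^ (p - r S)"
        by (metis Suc_diff_Suc Suc_lessD funpow_Suc_right)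
      then have "N (rot p ` S) = N S"
        using r(2)[OF S] * by (simp add: N_def image_comp)
      then show ?thesis
        using r(2)[OF S] * by (simp add: sel_def)
    qed
  qed
qed

section \<open>Alternating chains\<close>

text \<open>A simplicial chain is stored as its coefficient function on ordered simplices, given as
  lists. Adjacent swaps generate all permutations, so this is the usual sign rule for
  orientations.\<close>

definition alternating :: "('a list \<Rightarrow> int) \<Rightarrow> bool" where
  "alternating a \<longleftrightarrow> (\<forall>xs x y ys. a (xs @ x # y # ys) = - a (xs @ y # x # ys))"

lemma alternatingD: "alternating a \<Longrightarrow> a (xs @ x # y # ys) = - a (xs @ y # x # ys)"
  unfolding alternating_def by blast

lemma alternatingI:
  "(\<And>xs x y ys. a (xs @ x # y # ys) = - a (xs @ y # x # ys)) \<Longrightarrow> alternating a"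
  unfolding alternating_def by blast

lemma alternating_if: "alternating a \<Longrightarrow> alternating (\<lambda>ts. if P then a ts else 0)"
  by (cases P) (simp_all add: alternatingI)

lemma alternating_diff:
  assumes "alternating a" "alternating b"
  shows "alternating (\<lambda>ts. a ts - b ts)"
  unfolding alternating_def
proof (intro allI)
  fix xs ys :: "'a list" and x y :: 'a
  show "a (xs @ x # y # ys) - b (xs @ x # y # ys) = - (a (xs @ y # x # ys) - b (xs @ y # x # ys))"
    using alternatingD[OF assms(1), of xs x y ys] alternatingD[OF assms(2), of xs x y ys] by linarith
qed

lemma alternating_sum:
  assumes "\<And>i. alternating (f i)"
  shows "alternating (\<lambda>ts. \<Sum>i\<in>I. f i ts)"
  unfolding alternating_def sum_negf[symmetric]
  using alternatingD[OF assms] by (intro allI sum.cong refl)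

lemma alternating_mult: "alternating a \<Longrightarrow> alternating (\<lambda>ts. c * a ts)"
  by (rule alternatingI) (metis alternatingD mult_minus_right)

lemma alternating_Cons: "alternating a \<Longrightarrow> alternating (\<lambda>ts. a (v # ts))"
  by (rule alternatingI) (metis alternatingD append_Cons)

lemma alternating_map: "alternating a \<Longrightarrow> alternating (\<lambda>ts. a (map f ts))"
  by (rule alternatingI) (simp only: map_append list.simps(9), erule alternatingD)

text \<open>Swapping entries leaves the set of entries unchanged, so the choice among alternating
  functions may depend on that set, for instance through its equivariant index.\<close>

lemma alternating_set:
  assumes "\<And>S. alternating (f S)"
  shows "alternating (\<lambda>ts. f (set ts) ts)"
proof (rule alternatingI)
  fix xs ys :: "'a list" and x y :: 'a
  have "set (xs @ x # y # ys) = set (xs @ y # x # ys)"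
    by auto
  then show "f (set (xs @ x # y # ys)) (xs @ x # y # ys) = - f (set (xs @ y # x # ys)) (xs @ y # x # ys)"
    using alternatingD[OF assms] by metis
qed

text \<open>Adjacent swaps bring two equal entries next to each other; swapping these shows that the
  value is its own negative.\<close>

lemma alternating_not_distinct:
  assumes "alternating a" "\<not> distinct xs"
  shows "a xs = 0"
proof -
  obtain us y vs ws where xs: "xs = us @ [y] @ vs @ [y] @ ws"
    using not_distinct_decomp[OF assms(2)] by blast
  have "a (us @ y # vs @ y # ws) = 0" for us
  proof (induction vs arbitrary: us)
    case Nil
    then show ?case
      using alternatingD[OF assms(1), of us y y ws] by simp
  next
    case (Cons v vs)
    have "a (us @ y # v # vs @ y # ws) = - a ((us @ [v]) @ y # vs @ y # ws)"
      using alternatingD[OF assms(1), of us y v "vs @ y # ws"] by simp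
    then show ?case
      using Cons.IH[of "us @ [v]"] by simp
  qed
  then show ?thesis
    by (simp add: xs)
qed

text \<open>Contraction: \<open>contract v F u\<close> evaluates the functional \<open>F\<close> on the signed sum of the lists obtained from
  \<open>u\<close> by deleting one occurrence of \<open>v\<close>.\<close>

primrec contract :: "'a \<Rightarrow> ('a list \<Rightarrow> int) \<Rightarrow> 'a list \<Rightarrow> int" where
  "contract v F [] = 0"
| "contract v F (x # xs) = (if x = v then F xs else 0) - contract v (\<lambda>ys. F (x # ys)) xs"

lemma contract_uminus: "contract v (\<lambda>ys. - F ys) xs = - contract v F xs"
  by (induction xs arbitrary: F) auto

lemma contract_diff: "contract v (\<lambda>ys. F ys - G ys) xs = contract v F xs - contract v G xs"
  by (induction xs arbitrary: F G) auto

lemma contract_0 [simp]: "contract v (\<lambda>ys. 0) xs = 0"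
  by (induction xs) auto

text \<open>Two deletions may be made in either order, but making the left one first flips the sign
  of the right one. The antisymmetry of \<open>alt_list\<close> comes from this.\<close>

lemma contract_commute: "contract v (contract w F) xs = - contract w (contract v F) xs"
proof (induction xs arbitrary: F)
  case (Cons x xs)
  have *: "contract a (\<lambda>ys. if x = b then F ys else 0) xs = (if x = b then contract a F xs else 0)" for a b
    by simp
  show ?case
    by (simp only: contract.simps contract_diff * Cons.IH)
qed simp

lemma contract_nonzeroE:
  assumes "contract v F xs \<noteq> 0"
  obtains ys where "v \<in> set xs" "F ys \<noteq> 0" "set ys \<subseteq> set xs" "length xs = Suc (length ys)"
proof -
  have "v \<in> set xs \<and> (\<exists>ys. F ys \<noteq> 0 \<and> set ys \<subseteq> set xs \<and> length xs = Suc (length ys))"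
    using assms
  proof (induction xs arbitrary: F)
    case (Cons x xs)
    show ?case
    proof (cases "contract v (\<lambda>ys. F (x # ys)) xs = 0")
      case True
      then show ?thesis
        using Cons.prems by (auto split: if_splits)
    next
      case False
      then obtain ys where "v \<in> set xs" "F (x # ys) \<noteq> 0" "set ys \<subseteq> set xs" "length xs = Suc (length ys)"
        using Cons.IH by blast
      then show ?thesis
        by (intro conjI exI[of _ "x # ys"]) auto
    qed
  qed simp
  then show thesis
    using that by blast
qed

lemma contract_map:
  assumes "inj f"
  shows "contract (f v) F (map f xs) = contract v (\<lambda>ys. F (map f ys)) xs"
  by (induction xs arbitrary: F) (auto simp: inj_eq[OF assms])

text \<open>Every position of \<open>xs\<close> is deleted for exactly one \<open>v\<close> in
  \<open>V\<close>, so the sum runs over all faces with their usual signs.\<close>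

lemma sum_contract:
  assumes "finite V" "set xs \<subseteq> V"
  shows "(\<Sum>v\<in>V. contract v F xs) = (\<Sum>k<length xs. (-1) ^ k * F (take k xs @ drop (Suc k) xs))"
  using assms(2)
proof (induction xs arbitrary: F)
  case (Cons x xs)
  have "(\<Sum>v\<in>V. contract v F (x # xs)) = F xs - (\<Sum>v\<in>V. contract v (\<lambda>ys. F (x # ys)) xs)"
    using Cons.prems assms(1) by (simp add: sum_subtractf)
  also have "\<dots> = F xs + (\<Sum>k<length xs. - ((-1) ^ k * F (x # take k xs @ drop (Suc k) xs)))"
    using Cons by (simp add: sum_negf)
  finally show ?case
    by (simp only: length_Cons sum.lessThan_Suc_shift) simp
qed simp

text \<open>\<open>alt_list u\<close> is the antisymmetrisation of the elementary chain \<open>u\<close>: its value at \<open>ts\<close> is the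
  determinant of the matrix with entries \<open>[u ! a = ts ! b]\<close>, expanded along the first column.\<close>

primrec alt_list_at :: "'a list \<Rightarrow> 'a list \<Rightarrow> int" where
  "alt_list_at [] = (\<lambda>u. if u = [] then 1 else 0)"
| "alt_list_at (v # ts) = contract v (alt_list_at ts)"

definition alt_list :: "'a list \<Rightarrow> 'a list \<Rightarrow> int" where
  "alt_list u ts = alt_list_at ts u"

lemma alt_list_Cons: "alt_list u (v # ts) = contract v (\<lambda>w. alt_list w ts) u"
  by (simp add: alt_list_def)

lemma alternating_alt_list: "alternating (alt_list u)"
proof -
  have "alt_list_at (xs @ x # y # ys) u = - alt_list_at (xs @ y # x # ys) u" for xs x y and ys :: "'a list"
  proof (induction xs arbitrary: u)
    case Nil
    then show ?case
      using contract_commute[of x y] by simp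
  next
    case (Cons v xs)
    have "alt_list_at (xs @ x # y # ys) = (\<lambda>w. - alt_list_at (xs @ y # x # ys) w)"
      using Cons.IH by blast
    then show ?case
      by (simp add: contract_uminus)
  qed
  then show ?thesis
    unfolding alt_list_def by (rule alternatingI)
qed

lemma alt_list_nonzero:
  "alt_list u ts \<noteq> 0 \<Longrightarrow> length ts = length u \<and> set ts \<subseteq> set u"
proof (induction ts arbitrary: u)
  case (Cons v ts)
  then show ?case
    unfolding alt_list_Cons by (elim contract_nonzeroE) fastforce
qed (auto simp: alt_list_def split: if_splits)

lemma alt_list_map: "inj f \<Longrightarrow> alt_list (map f u) (map f ts) = alt_list u ts"
  by (induction ts arbitrary: u) (auto simp: alt_list_Cons contract_map alt_list_def[of _ "[]"])

text \<open>Antisymmetrisation commutes with the boundary, which is the sum over a prepended vertex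
  for alternating functions and the alternating sum of faces for lists.\<close>

lemma alt_list_boundary:
  assumes "finite V" "set u \<subseteq> V"
  shows "(\<Sum>v\<in>V. alt_list u (v # ts)) = (\<Sum>k<length u. (-1) ^ k * alt_list (take k u @ drop (Suc k) u) ts)"
  unfolding alt_list_Cons by (rule sum_contract[OF assms])

section \<open>Chains on the target complex over the group ring\<close>

definition block_chain :: "nat \<Rightarrow> nat \<Rightarrow> (nat list \<Rightarrow> int) \<Rightarrow> bool" where
  "block_chain p t a \<longleftrightarrow> alternating a \<and> (\<forall>ts. a ts \<noteq> 0 \<longrightarrow> blockwise_proper p t (set ts))"

text \<open>The complex is not augmented: \<open>blockwise_proper\<close> excludes the empty set, so
  the boundary has to vanish at the empty list.\<close>

definition bdry :: "nat \<Rightarrow> nat \<Rightarrow> (nat list \<Rightarrow> int) \<Rightarrow> nat list \<Rightarrow> int" where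
  "bdry p t a ts = (if ts = [] then 0 else \<Sum>v<t * p. a (v # ts))"

text \<open>In the group ring of the cyclic group generated by \<open>rot p\<close>, these are the operators
  \<open>\<nu> - 1\<close> (for even \<open>k\<close>) and \<open>1 + \<nu> + \<dots> + \<nu>\<^bsup>p-1\<^esup>\<close> (for odd \<open>k\<close>) of the periodic resolution.\<close>

definition rot_op :: "nat \<Rightarrow> nat \<Rightarrow> (nat list \<Rightarrow> int) \<Rightarrow> nat list \<Rightarrow> int" where
  "rot_op p k a ts = (if even k then a (map (rot p) ts) - a ts else \<Sum>i<p. a (map (rot p ^^ i) ts))"

lemma blockwise_proper_funpow_rot:
  "p > 0 \<Longrightarrow> blockwise_proper p t ((rot p ^^ i) ` S) \<longleftrightarrow> blockwise_proper p t S"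
proof (induction i)
  case (Suc i)
  then show ?case
    by (simp only: funpow.simps image_comp[symmetric] blockwise_proper_rot)
qed simp

lemma block_chain_diff:
  assumes "block_chain p t a" "block_chain p t b"
  shows "block_chain p t (\<lambda>ts. a ts - b ts)"
proof -
  have "alternating (\<lambda>ts. a ts - b ts)"
    using assms alternating_diff unfolding block_chain_def by blast
  moreover have "a ts \<noteq> 0 \<or> b ts \<noteq> 0" if "a ts - b ts \<noteq> 0" for ts
    using that by auto
  ultimately show ?thesis
    using assms unfolding block_chain_def by blast
qed

lemma block_chain_bdry:
  assumes "block_chain p t a"
  shows "block_chain p t (bdry p t a)"
proof -
  have a: "alternating a" and supp: "\<And>ts. a ts \<noteq> 0 \<Longrightarrow> blockwise_proper p t (set ts)"
    using assms by (auto simp: block_chain_def)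
  have "alternating (\<lambda>ts. \<Sum>v<t * p. a (v # ts))"
    by (intro alternating_sum alternating_Cons a)
  then have "alternating (bdry p t a)"
  proof (intro alternatingI)
    fix xs x y and ys :: "nat list"
    assume "alternating (\<lambda>ts. \<Sum>v<t * p. a (v # ts))"
    from alternatingD[OF this, of xs x y ys]
    show "bdry p t a (xs @ x # y # ys) = - bdry p t a (xs @ y # x # ys)"
      by (simp add: bdry_def)
  qed
  moreover have "blockwise_proper p t (set ts)" if nz: "bdry p t a ts \<noteq> 0" for ts
  proof -
    have "ts \<noteq> []"
      using nz by (auto simp: bdry_def)
    then have "(\<Sum>v<t * p. a (v # ts)) \<noteq> 0"
      using nz by (auto simp: bdry_def)
    then obtain v where "a (v # ts) \<noteq> 0"
      by (meson sum.not_neutral_contains_not_neutral)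
    then show ?thesis
      using supp[of "v # ts"] blockwise_proper_subset \<open>ts \<noteq> []\<close>
      by (metis set_empty set_subset_Cons)
  qed
  ultimately show ?thesis
    by (simp add: block_chain_def)
qed

text \<open>Exchanging the sums and swapping the first two entries shows that the sum is its own
  negative. Hence \<open>bdry\<close> squares to zero, and the augmentation of a boundary is
  zero.\<close>

lemma sum_alternating_pairs:
  assumes "alternating a"
  shows "(\<Sum>v<n. \<Sum>w<n. a (w # v # ts)) = 0"
proof -
  have "(\<Sum>v<n. \<Sum>w<n. a (w # v # ts)) = (\<Sum>v<n. \<Sum>w<n. a (v # w # ts))"
    by (rule sum.swap)
  also have "\<dots> = - (\<Sum>v<n. \<Sum>w<n. a (w # v # ts))"
    unfolding sum_negf[symmetric]
    by (intro sum.cong refl) (metis alternatingD[OF assms] append_Nil)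
  finally show ?thesis
    by simp
qed

lemma bdry_bdry: "alternating a \<Longrightarrow> bdry p t (bdry p t a) = (\<lambda>ts. 0)"
  by (rule ext) (simp add: bdry_def sum_alternating_pairs)

lemma bdry_diff: "bdry p t (\<lambda>ts. a ts - b ts) = (\<lambda>ts. bdry p t a ts - bdry p t b ts)"
  by (auto simp: bdry_def sum_subtractf)

lemma rot_op_diff: "rot_op p k (\<lambda>ts. a ts - b ts) = (\<lambda>ts. rot_op p k a ts - rot_op p k b ts)"
  by (auto simp: rot_op_def sum_subtractf)

lemma sum_funpow_rot:
  assumes "p > 0"
  shows "(\<Sum>v<t * p. f ((rot p ^^ i) v)) = (\<Sum>v<t * p. f v)"
proof (induction i)
  case (Suc i)
  then show ?case
    using sum_rot[OF assms, where f = "\<lambda>v. f ((rot p ^^ i) v)"] by (simp only: funpow_Suc_right o_apply)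
qed simp

lemma bdry_rot_op:
  assumes "p > 0"
  shows "bdry p t (rot_op p k a) = rot_op p k (bdry p t a)"
proof
  fix ts :: "nat list"
  have *: "(\<Sum>v<t * p. a ((rot p ^^ i) v # us)) = (\<Sum>v<t * p. a (v # us))" for i us
    by (rule sum_funpow_rot[OF assms])
  have "(\<Sum>v<t * p. \<Sum>i<p. a ((rot p ^^ i) v # map (rot p ^^ i) ts))
     = (\<Sum>i<p. \<Sum>v<t * p. a (v # map (rot p ^^ i) ts))"
    by (subst sum.swap) (simp add: *)
  then show "bdry p t (rot_op p k a) ts = rot_op p k (bdry p t a) ts"
    using *[of 1 "map (rot p) ts"] by (simp add: bdry_def rot_op_def sum_subtractf)
qed

text \<open>The chains supported on blockwise proper sets form a free module over the group ring, because
  the equivariant index picks one list out of each orbit.\<close>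

lemma rot_op_exact:
  assumes p: "prime p" and c: "block_chain p t c" and zero: "rot_op p k c = (\<lambda>ts. 0)"
  obtains g where "block_chain p t g" "rot_op p (Suc k) g = c"
proof -
  have p0: "p > 0"
    using p prime_gt_0_nat by auto
  have alt: "alternating c" and supp: "\<And>ts. c ts \<noteq> 0 \<Longrightarrow> blockwise_proper p t (set ts)"
    using c by (auto simp: block_chain_def)
  obtain r where r: "\<And>S. blockwise_proper p t S \<Longrightarrow> r S < p"
    "\<And>S. blockwise_proper p t S \<Longrightarrow> r (rot p ` S) = Suc (r S) mod p"
    using equivariant_index_exists[OF p] by blast
  have ri: "r ((rot p ^^ i) ` S) = (r S + i) mod p" if "blockwise_proper p t S" for i S
  proof (induction i)
    case 0
    then show ?case
      using r(1)[OF that] by simp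
  next
    case (Suc i)
    then show ?case
      using r(2)[of "(rot p ^^ i) ` S"] that blockwise_proper_funpow_rot[OF p0]
      by (simp add: image_comp mod_Suc_eq)
  qed
  show thesis
  proof (cases "even k")
    case True
    have inv: "c (map (rot p ^^ i) ts) = c ts" for i ts
    proof (induction i)
      case (Suc i)
      have "c (map (rot p) (map (rot p ^^ i) ts)) = c (map (rot p ^^ i) ts)"
        using fun_cong[OF zero, of "map (rot p ^^ i) ts"] True by (simp add: rot_op_def)
      then show ?case
        using Suc by (simp add: comp_def)
    qed simp
    \<comment> \<open>Here \<open>c\<close> is invariant under rotation, and the orbit of a list
      with blockwise proper set meets index 0 exactly once. Keeping \<open>c\<close> only there and
      summing over the orbit recovers \<open>c\<close>.\<close>
    define g where "g ts = (if r (set ts) = 0 then c ts else 0)" for ts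
    have "alternating (\<lambda>ts. if r S = 0 then c ts else 0)" for S
      by (rule alternating_if[OF alt])
    then have "alternating g"
      unfolding g_def by (rule alternating_set)
    then have "block_chain p t g"
      using supp by (auto simp: block_chain_def g_def)
    moreover have "rot_op p (Suc k) g ts = c ts" for ts
    proof (cases "blockwise_proper p t (set ts)")
      case False
      then have "g (map (rot p ^^ i) ts) = 0" for i
        using supp[of "map (rot p ^^ i) ts"] blockwise_proper_funpow_rot[OF p0] by (auto simp: g_def)
      then show ?thesis
        using True False supp by (auto simp: rot_op_def)
    next
      case pr: True
      define i0 where "i0 = (p - r (set ts)) mod p"
      have rlt: "r (set ts) < p"
        using r pr by auto
      have i0: "(r (set ts) + i) mod p = 0 \<longleftrightarrow> i = i0" if "i < p" for i
      proof (cases "r (set ts) = 0")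
        case False
        then have "i0 = p - r (set ts)"
          unfolding i0_def using rlt by (intro mod_less) linarith
        then show ?thesis
          using that rlt False by (auto simp: mod_if)
      qed (use that in \<open>simp add: i0_def\<close>)
      have "rot_op p (Suc k) g ts = (\<Sum>i<p. g (map (rot p ^^ i) ts))"
        using True by (simp add: rot_op_def)
      also have "\<dots> = (\<Sum>i<p. if i = i0 then c ts else 0)"
        by (rule sum.cong) (auto simp: g_def ri[OF pr] inv i0)
      also have "\<dots> = c ts"
        using p0 by (simp add: i0_def)
      finally show ?thesis .
    qed
    ultimately show thesis
      using that by blast
  next
    case False
    \<comment> \<open>A discrete antiderivative: \<open>g\<close> adds up \<open>c\<close> along the
      orbit, from the list of index 0 to the one just before \<open>ts\<close>. Rotating
      \<open>ts\<close> once adds the term \<open>c ts\<close>.\<close>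
    define g where "g ts = (\<Sum>i<r (set ts). c (map (rot p ^^ (p - r (set ts) + i)) ts))" for ts
    define g' where "g' ts = (if blockwise_proper p t (set ts) then g ts else 0)" for ts
    have "alternating (\<lambda>ts. \<Sum>i<r S. c (map (rot p ^^ (p - r S + i)) ts))" for S
      by (intro alternating_sum alternating_map alt)
    then have "alternating g"
      unfolding g_def by (rule alternating_set)
    then have "alternating (\<lambda>ts. if blockwise_proper p t S then g ts else 0)" for S
      by (rule alternating_if)
    then have "alternating g'"
      unfolding g'_def by (rule alternating_set)
    then have "block_chain p t g'"
      by (auto simp: block_chain_def g'_def)
    moreover have "rot_op p (Suc k) g' ts = c ts" for ts
    proof (cases "blockwise_proper p t (set ts)")
      case pr: False
      then have "\<not> blockwise_proper p t (set (map (rot p) ts))"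
        using blockwise_proper_rot[OF p0] by simp
      then show ?thesis
        using False pr supp by (auto simp: rot_op_def g'_def)
    next
      case pr: True
      define q where "q = r (set ts)"
      have qlt: "q < p"
        using r(1)[OF pr] q_def by simp
      have pr': "blockwise_proper p t (set (map (rot p) ts))"
        using pr blockwise_proper_rot[OF p0] by simp
      have op: "rot_op p (Suc k) g' ts = g (map (rot p) ts) - g ts"
        using False pr pr' by (simp add: rot_op_def g'_def)
      have rq: "r (set (map (rot p) ts)) = Suc q mod p"
        using r(2)[OF pr] by (simp add: q_def)
      have per: "map (rot p ^^ (p + i)) ts = map (rot p ^^ i) ts" for i
        using p0 by (simp add: funpow_add)
      have gplus: "g ts + c ts = (\<Sum>i<Suc q. c (map (rot p ^^ (p - q + i)) ts))"
        using qlt per[of 0] by (simp add: g_def q_def)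
      show ?thesis
      proof (cases "Suc q = p")
        case True
        \<comment> \<open>The index wraps round to 0, where \<open>g\<close> is 0. The
          antiderivative closes up because the sum of \<open>c\<close> over the whole orbit
          vanishes.\<close>
        have "(\<Sum>i<p. c (map (rot p ^^ Suc i) ts)) = (\<Sum>i<p. c (map (rot p ^^ i) (map (rot p) ts)))"
          by (simp add: funpow_Suc_right del: funpow.simps)
        also have "\<dots> = 0"
          using fun_cong[OF zero, of "map (rot p) ts"] False by (simp add: rot_op_def)
        finally have "(\<Sum>i<p. c (map (rot p ^^ Suc i) ts)) = 0" .
        moreover have "p - q = 1"
          using True by simp
        ultimately have "g ts + c ts = 0"
          using gplus True by (simp only: plus_1_eq_Suc)
        moreover have "g (map (rot p) ts) = 0"
          using rq True by (simp add: g_def)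
        ultimately show ?thesis
          using op by simp
      next
        case False
        then have lt: "Suc q < p"
          using qlt by simp
        have "g (map (rot p) ts) = (\<Sum>i<Suc q. c (map (rot p ^^ Suc (p - Suc q + i)) ts))"
          unfolding g_def rq using lt by (simp add: funpow_Suc_right del: funpow.simps sum.lessThan_Suc)
        also have "\<dots> = (\<Sum>i<Suc q. c (map (rot p ^^ (p - q + i)) ts))"
          using lt by (intro sum.cong arg_cong[where f = c] arg_cong2[where f = map] arg_cong2[where f = "(^^)"]) auto
        finally show ?thesis
          using op gplus by simp
      qed
    qed
    ultimately show thesis
      using that by blast
  qed
qed

text \<open>Going down from \<open>a n = 0\<close>, each \<open>a m\<close> is a boundary plus a
  value of the operator numbered \<open>Suc m\<close>: the representation of
  \<open>a (Suc m)\<close> shows that the operator numbered \<open>m\<close> kills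
  \<open>a m - bdry p t g\<close>, and exactness applies. For \<open>a 0\<close> that operator is
  the norm, so its augmentation is a multiple of \<open>p\<close>, while boundaries have
  augmentation 0.\<close>

lemma dvd_augmentation:
  assumes p: "prime p"
    and chain: "\<And>k. k \<le> n \<Longrightarrow> block_chain p t (a k)"
    and bdry: "\<And>k. k < n \<Longrightarrow> bdry p t (a (Suc k)) = rot_op p k (a k)"
    and top: "a n = (\<lambda>ts. 0)"
  shows "int p dvd (\<Sum>v<t * p. a 0 [v])"
proof -
  have p0: "p > 0"
    using p prime_gt_0_nat by auto
  have z: "block_chain p t (\<lambda>ts. 0)"
    by (simp add: block_chain_def alternating_def)
  have "\<exists>g g'. block_chain p t g \<and> block_chain p t g' \<and>
      a (n - k) = (\<lambda>ts. bdry p t g' ts + rot_op p (Suc (n - k)) g ts)" if "k \<le> n" for k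
    using that
  proof (induction k)
    case 0
    show ?case
      by (intro exI[of _ "\<lambda>ts. 0"]) (auto simp: z top bdry_def rot_op_def fun_eq_iff)
  next
    case (Suc k)
    define m where "m = n - Suc k"
    have m: "n - k = Suc m" "m < n"
      using Suc.prems by (auto simp: m_def)
    obtain g g' where g: "block_chain p t g" "block_chain p t g'"
      "a (Suc m) = (\<lambda>ts. bdry p t g' ts + rot_op p (Suc (Suc m)) g ts)"
      using Suc m by auto
    have "rot_op p m (a m) = bdry p t (a (Suc m))"
      using bdry m by simp
    \<comment> \<open>The operator depends only on the parity of its number, so
      \<open>Suc (Suc m)\<close> acts as \<open>m\<close>. The sum is written as a difference to fit
      \<open>bdry_diff\<close>.\<close>
    also have "\<dots> = (\<lambda>ts. bdry p t (rot_op p m g) ts - bdry p t (\<lambda>ts. - bdry p t g' ts) ts)"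
      unfolding g(3) bdry_diff[symmetric] by (simp add: rot_op_def add.commute)
    also have "bdry p t (\<lambda>ts. - bdry p t g' ts) = (\<lambda>ts. - bdry p t (bdry p t g') ts)"
      by (auto simp: bdry_def sum_negf)
    also have "bdry p t (bdry p t g') = (\<lambda>ts. 0)"
      using bdry_bdry g(2) block_chain_def by auto
    finally have "rot_op p m (a m) = rot_op p m (bdry p t g)"
      using bdry_rot_op[OF p0] by simp
    then have "rot_op p m (\<lambda>ts. a m ts - bdry p t g ts) = (\<lambda>ts. 0)"
      by (simp add: rot_op_diff)
    moreover have "block_chain p t (\<lambda>ts. a m ts - bdry p t g ts)"
      using block_chain_diff chain block_chain_bdry g(1) m by simp
    ultimately obtain h where h: "block_chain p t h" "rot_op p (Suc m) h = (\<lambda>ts. a m ts - bdry p t g ts)"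
      using rot_op_exact[OF p] by blast
    then have "a m = (\<lambda>ts. bdry p t g ts + rot_op p (Suc m) h ts)"
      by simp
    then show ?case
      using g(1) h(1) m_def by blast
  qed
  from this[of n] obtain g g' where g: "block_chain p t g'"
    "a 0 = (\<lambda>ts. bdry p t g' ts + rot_op p (Suc 0) g ts)"
    by auto
  have "(\<Sum>v<t * p. bdry p t g' [v]) = 0"
    using sum_alternating_pairs[where a = g' and n = "t * p" and ts = "[]"] g(1) by (simp add: bdry_def block_chain_def)
  moreover have "(\<Sum>v<t * p. rot_op p (Suc 0) g [v]) = (\<Sum>i<p. \<Sum>v<t * p. g [(rot p ^^ i) v])"
    by (simp add: rot_op_def) (rule sum.swap)
  moreover have "\<dots> = int p * (\<Sum>v<t * p. g [v])"
    using sum_funpow_rot[OF p0, where f = "\<lambda>v. g [v]" and t = t] by simp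
  ultimately show ?thesis
    by (simp add: g(2) sum.distrib)
qed

section \<open>Chains in the join\<close>

definition reindex :: "(nat \<Rightarrow> nat) \<Rightarrow> (nat \<Rightarrow> real) \<Rightarrow> nat \<Rightarrow> real" where
  "reindex f x = (\<lambda>m. x (f m))"

lemma reindex_apply [simp]: "reindex f x m = x (f m)"
  by (simp add: reindex_def)

lemma reindex_id [simp]: "reindex id x = x"
  by (simp add: reindex_def)

lemma reindex_reindex: "reindex f (reindex g x) = reindex (g \<circ> f) x"
  by (simp add: reindex_def)

definition unit_vec :: "nat \<Rightarrow> nat \<Rightarrow> real" where
  "unit_vec i = (\<lambda>j. if j = i then 1 else 0)"

text \<open>The join of \<open>k + 1\<close> copies of the discrete space with \<open>p\<close> points: coordinate \<open>l * p + i\<close> is the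
  weight of the point \<open>i\<close> in the \<open>l\<close>-th copy, and each copy carries weight on at most one point.\<close>

definition join_space :: "nat \<Rightarrow> nat \<Rightarrow> (nat \<Rightarrow> real) set" where
  "join_space p k = {x. (\<forall>m. 0 \<le> x m) \<and> (\<forall>m\<ge>Suc k * p. x m = 0) \<and> (\<Sum>m<Suc k * p. x m) = 1 \<and>
     (\<forall>m m'. x m \<noteq> 0 \<longrightarrow> x m' \<noteq> 0 \<longrightarrow> m div p = m' div p \<longrightarrow> m = m')}"

lemma join_spaceD:
  assumes "x \<in> join_space p k"
  shows "0 \<le> x m" "m \<ge> Suc k * p \<Longrightarrow> x m = 0" "(\<Sum>m<Suc k * p. x m) = 1"
    "x m \<noteq> 0 \<Longrightarrow> x m' \<noteq> 0 \<Longrightarrow> m div p = m' div p \<Longrightarrow> m = m'"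
  using assms unfolding join_space_def by blast+

lemma join_space_mono:
  assumes "k \<le> n"
  shows "join_space p k \<subseteq> join_space p n"
proof
  fix x assume x: "x \<in> join_space p k"
  have le: "Suc k * p \<le> Suc n * p"
    using assms by (intro mult_right_mono) auto
  have "(\<Sum>m<Suc n * p. x m) = (\<Sum>m<Suc k * p. x m)"
    using le join_spaceD(2)[OF x] by (intro sum.mono_neutral_right) auto
  moreover have "\<forall>m\<ge>Suc n * p. x m = 0"
    using le join_spaceD(2)[OF x] order_trans by blast
  ultimately show "x \<in> join_space p n"
    using x unfolding join_space_def by simp
qed

lemma join_space_rot:
  assumes "p > 0" "x \<in> join_space p k"
  shows "reindex (rot p) x \<in> join_space p k"
proof -
  have "(\<Sum>m<Suc k * p. x (rot p m)) = 1"
    using join_spaceD(3)[OF assms(2)] sum_rot[OF assms(1), where k = "Suc k" and f = x] by simp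
  moreover have "x (rot p m) = 0" if "m \<ge> Suc k * p" for m
    using that join_spaceD(2)[OF assms(2)] rot_less_iff[OF assms(1), of m "Suc k"] by (meson leI not_le)
  moreover have "m = m'" if "x (rot p m) \<noteq> 0" "x (rot p m') \<noteq> 0" "m div p = m' div p" for m m'
    using join_spaceD(4)[OF assms(2) that(1,2)] that(3) assms(1) inj_rot[OF assms(1)]
    by (simp add: inj_eq)
  ultimately show ?thesis
    unfolding join_space_def using join_spaceD(1)[OF assms(2)] by auto
qed

lemma join_space_funpow_rot:
  assumes "p > 0" "x \<in> join_space p k"
  shows "reindex (rot p ^^ i) x \<in> join_space p k"
proof (induction i)
  case (Suc i)
  then show ?case
    using join_space_rot[OF assms(1) Suc] by (simp only: reindex_reindex funpow_Suc_right)
qed (simp only: assms funpow.simps reindex_id)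

text \<open>The apex is point 0 of the new copy, in which \<open>x\<close> has no weight, so each
  copy still carries weight on at most one point.\<close>

lemma join_space_cone:
  assumes "p > 0" "x \<in> join_space p k" "0 \<le> u" "u \<le> 1"
  shows "(\<lambda>i. (1 - u) * unit_vec (Suc k * p) i + u * x i) \<in> join_space p (Suc k)"
proof -
  let ?v = "unit_vec (Suc k * p)" and ?y = "\<lambda>i. (1 - u) * unit_vec (Suc k * p) i + u * x i"
  have zero: "x m = 0" if "m \<ge> Suc k * p" for m
    using join_spaceD(2)[OF assms(2)] that by simp
  have "(\<Sum>m<Suc (Suc k) * p. x m) = (\<Sum>m<Suc k * p. x m)"
    using zero by (intro sum.mono_neutral_right) auto
  then have sx: "(\<Sum>m<Suc (Suc k) * p. x m) = 1"
    using join_spaceD(3)[OF assms(2)] by simp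
  have sv: "(\<Sum>m<Suc (Suc k) * p. ?v m) = 1"
    using assms(1) by (simp add: unit_vec_def)
  have "(\<Sum>m<Suc (Suc k) * p. ?y m) = (1 - u) * (\<Sum>m<Suc (Suc k) * p. ?v m) + u * (\<Sum>m<Suc (Suc k) * p. x m)"
    by (simp only: sum.distrib sum_distrib_left)
  then have 1: "(\<Sum>m<Suc (Suc k) * p. ?y m) = 1"
    using sx sv by simp
  have 2: "?y m = 0" if "m \<ge> Suc (Suc k) * p" for m
    using that zero[of m] assms(1) by (auto simp: unit_vec_def)
  have 3: "?y m \<ge> 0" for m
    using assms join_spaceD(1)[OF assms(2)] by (simp add: unit_vec_def)
  have 4: "m = m'" if "?y m \<noteq> 0" "?y m' \<noteq> 0" "m div p = m' div p" for m m'
  proof -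
    have "m = Suc k * p \<or> x m \<noteq> 0" "m' = Suc k * p \<or> x m' \<noteq> 0"
      using that by (auto simp: unit_vec_def split: if_splits)
    moreover have "m div p < Suc k" if "x m \<noteq> 0" for m
      using zero[of m] that assms(1) by (meson div_less_iff_less_mult not_le)
    ultimately show ?thesis
      using join_spaceD(4)[OF assms(2)] that(3) assms(1)
      by (metis nat_less_le nonzero_mult_div_cancel_right)
  qed
  show ?thesis
    unfolding join_space_def using 1 2 3 4 by blast
qed

section \<open>The equivariant chains in the join\<close>

text \<open>The counterpart of \<open>rot_op\<close> on singular chains.\<close>

definition chain_op :: "nat \<Rightarrow> nat \<Rightarrow> nat \<Rightarrow> (nat \<Rightarrow> real) chain \<Rightarrow> (nat \<Rightarrow> real) chain" where
  "chain_op p k q c = (if even k then chain_map q (reindex (rot p)) c - c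
     else \<Sum>i<p. chain_map q (reindex (rot p ^^ i)) c)"

text \<open>These are the chains \<open>h\<^sub>k\<close>. The base of each cone is a cycle, or has
  augmentation 0 in degree 0, so the boundary of the cone is its base.\<close>

primrec join_chain :: "nat \<Rightarrow> nat \<Rightarrow> (nat \<Rightarrow> real) chain" where
  "join_chain p 0 = frag_of (\<lambda>x\<in>standard_simplex 0. unit_vec 0)"
| "join_chain p (Suc k) = simplicial_cone k (unit_vec (Suc k * p)) (chain_op p k k (join_chain p k))"

lemma simplicial_chain_reindex:
  assumes c: "simplicial_chain q S c" and f: "\<And>x. x \<in> S \<Longrightarrow> reindex f x \<in> T"
  shows "simplicial_chain q T (chain_map q (reindex f) c)"
  using c unfolding simplicial_chain_def
proof (induction c rule: frag_induction)
  case (one g)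
  then obtain l where g: "g ` standard_simplex q \<subseteq> S" "g = oriented_simplex q l"
    by (auto simp: simplicial_simplex)
  have "simplex_map q (reindex f) g = oriented_simplex q (\<lambda>j. l j \<circ> f)"
    by (auto simp: simplex_map_def g(2) oriented_simplex_def fun_eq_iff)
  moreover have "simplex_map q (reindex f) g ` standard_simplex q \<subseteq> T"
    using g(1) f by (auto simp: simplex_map_def)
  ultimately have "simplicial_simplex q T (simplex_map q (reindex f) g)"
    unfolding simplicial_simplex by blast
  then show ?case
    by (simp del: reindex_apply)
next
  case (diff a b)
  then show ?case
    by (metis chain_map_diff simplicial_chain_def simplicial_chain_diff)
qed simp

lemma simplicial_chain_op:
  assumes "p > 0" "simplicial_chain q (join_space p n) c"
  shows "simplicial_chain q (join_space p n) (chain_op p k q c)"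
  unfolding chain_op_def
  using assms join_space_rot join_space_funpow_rot
  by (auto intro!: simplicial_chain_diff simplicial_chain_sum simplicial_chain_reindex)

lemma simplicial_join_chain:
  assumes "p > 0"
  shows "simplicial_chain k (join_space p k) (join_chain p k)"
proof (induction k)
  case 0
  have "(\<lambda>x\<in>standard_simplex 0. unit_vec 0) = oriented_simplex 0 (\<lambda>j. unit_vec 0)"
    by (auto simp: oriented_simplex_def standard_simplex_0 fun_eq_iff)
  moreover have "unit_vec 0 \<in> join_space p 0"
    using assms by (auto simp: join_space_def unit_vec_def)
  ultimately show ?case
    by (simp only: join_chain.simps simplicial_chain_of simplicial_simplex)
      (auto simp: standard_simplex_0 oriented_simplex_def)
next
  case (Suc k)
  then show ?case
    using simplicial_chain_simplicial_cone[OF simplicial_chain_op[OF assms Suc, of k], where T = "join_space p (Suc k)"]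
      join_space_cone[OF assms] by simp
qed

lemma chain_boundary_chain_op:
  assumes "singular_chain q X c"
  shows "chain_boundary q (chain_op p k q c) = chain_op p k (q - 1) (chain_boundary q c)"
  by (simp add: chain_op_def chain_boundary_diff chain_boundary_sum chain_boundary_chain_map[OF assms] o_def)

lemma chain_op_chain_op_Suc:
  assumes p: "p > 0" and c: "singular_chain q X c"
  shows "chain_op p (Suc k) q (chain_op p k q c) = 0"
proof -
  define M where "M i = chain_map q (reindex (rot p ^^ i)) c" for i
  have comp: "chain_map q (reindex (rot p ^^ i)) (M j) = M (i + j)" for i j
  proof -
    have "reindex (rot p ^^ (i + j)) = (reindex (rot p ^^ i)) \<circ> (reindex (rot p ^^ j))"
      by (auto simp: fun_eq_iff add.commute[of i j] funpow_add reindex_reindex)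
    then show ?thesis
      by (simp add: M_def chain_map_compose)
  qed
  have M0: "M 0 = c"
    unfolding M_def using c by (intro chain_map_id_gen) auto
  have Mp: "M p = c"
    unfolding M_def using c p by (intro chain_map_id_gen) auto
  have "(\<Sum>i<p. M (Suc i)) - (\<Sum>i<p. M i) = M p - M 0"
    using sum_lessThan_telescope[of M p] by (simp add: sum_subtractf)
  then have tel: "(\<Sum>i<p. M (Suc i)) = (\<Sum>i<p. M i)"
    using M0 Mp by simp
  have rot: "rot p = rot p ^^ 1"
    by simp
  show ?thesis
  proof (cases "even k")
    case True
    then have "chain_op p k q c = M 1 - M 0"
      by (simp add: chain_op_def M0) (simp add: M_def)
    then have "chain_op p (Suc k) q (chain_op p k q c) = (\<Sum>i<p. M (i + 1) - M (i + 0))"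
      using True by (simp add: chain_op_def chain_map_diff comp del: One_nat_def add_0_right)
    then show ?thesis
      using tel by (simp add: sum_subtractf)
  next
    case False
    then have "chain_op p k q c = (\<Sum>i<p. M i)"
      by (simp add: chain_op_def M_def)
    moreover have "chain_map q (reindex (rot p)) (M i) = M (Suc i)" for i
      using comp[of 1 i] by simp
    ultimately show ?thesis
      using False tel by (simp add: chain_op_def chain_map_sum comp_def)
  qed
qed

text \<open>The boundary of a cone is its base up to a correction. For \<open>k = 0\<close> this is
  the augmentation of the base at the apex, which \<nu> - 1 annihilates; later it is the cone over
  the boundary of the base, which contains two consecutive operators and vanishes.\<close>

lemma chain_boundary_join_chain:
  assumes "p > 0"
  shows "chain_boundary (Suc k) (join_chain p (Suc k)) = chain_op p k k (join_chain p k)"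
proof (induction k)
  case 0
  have "frag_extend (\<lambda>f. frag_of (\<lambda>u\<in>standard_simplex 0. unit_vec (Suc 0 * p))) (chain_op p 0 0 (join_chain p 0)) = 0"
    by (simp add: chain_op_def frag_extend_diff)
  then show ?case
    using chain_boundary_simplicial_cone[OF simplicial_chain_op[OF assms simplicial_join_chain[OF assms, of 0], of 0],
        of "unit_vec (Suc 0 * p)"]
    by (simp only: join_chain.simps(2) if_True diff_zero simp_thms)
next
  case (Suc k)
  have s: "singular_chain i (subtopology (powertop_real UNIV) (join_space p i)) (join_chain p i)" for i
    using simplicial_imp_singular_chain simplicial_join_chain[OF assms] by blast
  have "chain_boundary (Suc k) (chain_op p (Suc k) (Suc k) (join_chain p (Suc k)))
      = chain_op p (Suc k) k (chain_op p k k (join_chain p k))"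
    using chain_boundary_chain_op[OF s[of "Suc k"]] Suc by simp
  also have "\<dots> = 0"
    by (rule chain_op_chain_op_Suc[OF assms s])
  finally have "simplicial_cone k (unit_vec (Suc (Suc k) * p))
      (chain_boundary (Suc k) (chain_op p (Suc k) (Suc k) (join_chain p (Suc k)))) = 0"
    by (simp add: simplicial_cone_def)
  then show ?case
    using chain_boundary_simplicial_cone[OF simplicial_chain_op[OF assms simplicial_join_chain[OF assms, of "Suc k"], of "Suc k"],
        of "unit_vec (Suc (Suc k) * p)"]
    by (simp only: join_chain.simps(2)[of p "Suc k"] if_False diff_zero simp_thms nat.distinct diff_Suc_1)
qed

section \<open>Chains of labels\<close>

definition frag_eval :: "('a \<Rightarrow> int) \<Rightarrow> ('a \<Rightarrow>\<^sub>0 int) \<Rightarrow> int" where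
  "frag_eval G c = (\<Sum>s\<in>Poly_Mapping.keys c. Poly_Mapping.lookup c s * G s)"

lemma frag_eval_superset:
  assumes "finite A" "Poly_Mapping.keys c \<subseteq> A"
  shows "frag_eval G c = (\<Sum>s\<in>A. Poly_Mapping.lookup c s * G s)"
  unfolding frag_eval_def using assms
  by (intro sum.mono_neutral_left) (auto simp: in_keys_iff)

lemma frag_eval_0 [simp]: "frag_eval G 0 = 0"
  by (simp add: frag_eval_def)

lemma frag_eval_of [simp]: "frag_eval G (frag_of s) = G s"
  by (simp add: frag_eval_def)

lemma frag_eval_diff: "frag_eval G (c - d) = frag_eval G c - frag_eval G d"
proof -
  let ?A = "Poly_Mapping.keys c \<union> Poly_Mapping.keys d"
  have "frag_eval G b = (\<Sum>s\<in>?A. Poly_Mapping.lookup b s * G s)" if "b \<in> {c, d, c - d}" for b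
    using that keys_diff[of c d] by (intro frag_eval_superset) auto
  then show ?thesis
    by (simp add: lookup_minus left_diff_distrib sum_subtractf)
qed

lemma frag_eval_uminus: "frag_eval G (- c) = - frag_eval G c"
  using frag_eval_diff[of G 0 c] by simp

lemma frag_eval_add: "frag_eval G (c + d) = frag_eval G c + frag_eval G d"
  using frag_eval_diff[of G c "- d"] by (simp add: frag_eval_uminus)

lemma frag_eval_sum: "frag_eval G (sum f I) = (\<Sum>i\<in>I. frag_eval G (f i))"
  by (induction I rule: infinite_finite_induct) (auto simp: frag_eval_add)

lemma frag_eval_cmul: "frag_eval G (frag_cmul k c) = k * frag_eval G c"
  using frag_eval_superset[OF finite_keys keys_cmul, of G k c]
  by (simp add: frag_eval_def sum_distrib_left mult.assoc)

lemma frag_eval_extend: "frag_eval G (frag_extend f c) = frag_eval (\<lambda>s. frag_eval G (f s)) c"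
  by (simp add: frag_extend_def frag_eval_sum frag_eval_cmul frag_eval_def[of _ c])

lemma frag_eval_cong:
  "(\<And>s. s \<in> Poly_Mapping.keys c \<Longrightarrow> G s = H s) \<Longrightarrow> frag_eval G c = frag_eval H c"
  by (simp add: frag_eval_def)

definition vertex_labels :: "('a \<Rightarrow> 'b) \<Rightarrow> nat \<Rightarrow> ((nat \<Rightarrow> real) \<Rightarrow> 'a) \<Rightarrow> 'b list" where
  "vertex_labels lab q s = map (\<lambda>i. lab (s (unit_vec i))) [0..<Suc q]"

text \<open>The chain map induced by \<open>lab\<close>: each singular simplex goes to the oriented
  simplex on the labels of its vertices, and to 0 if a label repeats.\<close>

definition label_chain :: "('a \<Rightarrow> 'b) \<Rightarrow> nat \<Rightarrow> 'a chain \<Rightarrow> 'b list \<Rightarrow> int" where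
  "label_chain lab q c ts = frag_eval (\<lambda>s. alt_list (vertex_labels lab q s) ts) c"

lemma unit_vec_in_standard_simplex: "i \<le> q \<Longrightarrow> unit_vec i \<in> standard_simplex q"
  by (simp add: unit_vec_def)

lemma length_vertex_labels [simp]: "length (vertex_labels lab q s) = Suc q"
  by (simp add: vertex_labels_def)

lemma set_vertex_labels: "set (vertex_labels lab q s) \<subseteq> lab ` s ` standard_simplex q"
  using unit_vec_in_standard_simplex by (fastforce simp: vertex_labels_def)

lemma vertex_labels_singular_face:
  assumes "k \<le> Suc q"
  shows "vertex_labels lab q (singular_face (Suc q) k s)
    = take k (vertex_labels lab (Suc q) s) @ drop (Suc k) (vertex_labels lab (Suc q) s)"
proof (rule nth_equalityI)
  fix i assume "i < length (vertex_labels lab q (singular_face (Suc q) k s))"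
  then have i: "i \<le> q"
    by simp
  have "simplical_face k (unit_vec i) = unit_vec (if i < k then i else Suc i)"
    by (auto simp: simplical_face_def unit_vec_def fun_eq_iff)
  then have "singular_face (Suc q) k s (unit_vec i) = s (unit_vec (if i < k then i else Suc i))"
    using unit_vec_in_standard_simplex[OF i] by (simp add: singular_face_def)
  then show "vertex_labels lab q (singular_face (Suc q) k s) ! i
    = (take k (vertex_labels lab (Suc q) s) @ drop (Suc k) (vertex_labels lab (Suc q) s)) ! i"
    using i assms by (simp add: vertex_labels_def nth_append del: upt_Suc)
qed (use assms in simp)

lemma label_chain_boundary:
  assumes "finite V" "\<And>s. s \<in> Poly_Mapping.keys c \<Longrightarrow> set (vertex_labels lab (Suc q) s) \<subseteq> V"
  shows "label_chain lab q (chain_boundary (Suc q) c) ts = (\<Sum>v\<in>V. label_chain lab (Suc q) c (v # ts))"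
proof -
  let ?u = "vertex_labels lab (Suc q)"
  have "label_chain lab q (chain_boundary (Suc q) c) ts
      = frag_eval (\<lambda>s. \<Sum>k\<le>Suc q. (-1) ^ k * alt_list (take k (?u s) @ drop (Suc k) (?u s)) ts) c"
    by (simp add: label_chain_def chain_boundary_def frag_eval_extend frag_eval_sum frag_eval_cmul
        vertex_labels_singular_face del: sum.atMost_Suc)
  also have "\<dots> = frag_eval (\<lambda>s. \<Sum>v\<in>V. alt_list (?u s) (v # ts)) c"
  proof (rule frag_eval_cong)
    fix s assume "s \<in> Poly_Mapping.keys c"
    from alt_list_boundary[OF assms(1) assms(2)[OF this], of ts]
    show "(\<Sum>k\<le>Suc q. (-1) ^ k * alt_list (take k (?u s) @ drop (Suc k) (?u s)) ts)
        = (\<Sum>v\<in>V. alt_list (?u s) (v # ts))"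
      by (simp only: length_vertex_labels lessThan_Suc_atMost)
  qed
  also have "\<dots> = (\<Sum>v\<in>V. label_chain lab (Suc q) c (v # ts))"
    unfolding label_chain_def frag_eval_def sum_distrib_left by (rule sum.swap)
  finally show ?thesis .
qed

text \<open>On labels \<open>f\<close> undoes the effect of \<open>g\<close>. Applying the injective
  \<open>f\<close> to both arguments of \<open>alt_list\<close> moves the map from the simplex to
  the list.\<close>

lemma label_chain_chain_map:
  assumes "inj f" "\<And>x. x \<in> E \<Longrightarrow> f (lab (g x)) = lab x" "singular_chain q (subtopology X E) c"
  shows "label_chain lab q (chain_map q g c) ts = label_chain lab q c (map f ts)"
proof -
  have "alt_list (vertex_labels lab q (simplex_map q g s)) ts = alt_list (vertex_labels lab q s) (map f ts)"
    if "s \<in> Poly_Mapping.keys c" for s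
  proof -
    have "s ` standard_simplex q \<subseteq> E"
      using assms(3) that by (simp add: singular_chain_subtopology)
    then have "f (lab (simplex_map q g s (unit_vec i))) = lab (s (unit_vec i))" if "i \<le> q" for i
      using unit_vec_in_standard_simplex[OF that] assms(2) by (auto simp: simplex_map_def)
    then have "map f (vertex_labels lab q (simplex_map q g s)) = vertex_labels lab q s"
      by (auto simp: vertex_labels_def)
    then show ?thesis
      using alt_list_map[OF assms(1)] by metis
  qed
  then show ?thesis
    unfolding label_chain_def chain_map_def frag_eval_extend o_def frag_eval_of by (rule frag_eval_cong)
qed

lemma alternating_label_chain: "alternating (label_chain lab q c)"
  unfolding label_chain_def frag_eval_def
  by (intro alternating_sum alternating_mult alternating_alt_list)

lemma label_chain_nonzeroE:
  assumes "label_chain lab q c ts \<noteq> 0"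
  obtains s where "s \<in> Poly_Mapping.keys c" "set ts \<subseteq> lab ` s ` standard_simplex q" "length ts = Suc q"
proof -
  obtain s where s: "s \<in> Poly_Mapping.keys c" "alt_list (vertex_labels lab q s) ts \<noteq> 0"
    using assms unfolding label_chain_def frag_eval_def
    by (metis (no_types, lifting) mult_zero_right sum.neutral)
  then show thesis
    using that alt_list_nonzero[OF s(2)] set_vertex_labels by (metis length_vertex_labels order_trans)
qed

lemma label_chain_chain_op:
  assumes p: "p > 0" and lab: "\<And>x. x \<in> join_space p n \<Longrightarrow> rot p (lab (reindex (rot p) x)) = lab x"
    and c: "singular_chain q (subtopology X (join_space p n)) c"
  shows "label_chain lab q (chain_op p k q c) = rot_op p k (label_chain lab q c)"
proof
  fix ts
  have lab_i: "(rot p ^^ i) (lab (reindex (rot p ^^ i) x)) = lab x" if "x \<in> join_space p n" for i x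
  proof (induction i)
    case (Suc i)
    have "rot p (lab (reindex (rot p ^^ Suc i) x)) = lab (reindex (rot p ^^ i) x)"
      using lab[OF join_space_funpow_rot[OF p that]] by (simp only: reindex_reindex funpow_Suc_right)
    then show ?case
      using Suc by (metis comp_apply funpow_Suc_right)
  qed (simp add: reindex_def)
  have "inj (rot p ^^ i)" for i
    using inj_rot[OF p] by simp
  then have "label_chain lab q (chain_map q (reindex (rot p ^^ i)) c) ts = label_chain lab q c (map (rot p ^^ i) ts)" for i
    using lab_i c by (rule label_chain_chain_map)
  moreover have "label_chain lab q (chain_map q (reindex (rot p)) c) ts = label_chain lab q c (map (rot p) ts)"
    using inj_rot[OF p] lab c by (rule label_chain_chain_map)
  ultimately show "label_chain lab q (chain_op p k q c) ts = rot_op p k (label_chain lab q c) ts"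
    by (simp add: chain_op_def rot_op_def label_chain_def frag_eval_diff frag_eval_sum)
qed

section \<open>Subdivision and the obstruction to a labelling\<close>

lemma singular_subdivision_chain_op:
  assumes "singular_chain q X c"
  shows "singular_subdivision q (chain_op p k q c) = chain_op p k q (singular_subdivision q c)"
proof -
  have "singular_subdivision q (sum f I) = (\<Sum>i\<in>I. singular_subdivision q (f i))"
    for f :: "nat \<Rightarrow> (nat \<Rightarrow> real) chain" and I
    by (induction I rule: infinite_finite_induct) (auto simp: singular_subdivision_add)
  then show ?thesis
    by (simp add: chain_op_def singular_subdivision_diff naturality_singular_subdivision[OF assms])
qed

lemma singular_chain_subdivision_power:
  "singular_chain q X c \<Longrightarrow> singular_chain q X ((singular_subdivision q ^^ N) c)"
  by (induction N) (auto simp: singular_chain_singular_subdivision)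

lemma subdivision_power_chain_op:
  assumes "singular_chain q X c"
  shows "(singular_subdivision q ^^ N) (chain_op p k q c) = chain_op p k q ((singular_subdivision q ^^ N) c)"
  using singular_subdivision_chain_op[OF singular_chain_subdivision_power[OF assms]]
  by (induction N) auto

lemma chain_boundary_subdivision_power:
  assumes "singular_chain (Suc q) X c"
  shows "chain_boundary (Suc q) ((singular_subdivision (Suc q) ^^ N) c)
    = (singular_subdivision q ^^ N) (chain_boundary (Suc q) c)"
  using chain_boundary_singular_subdivision[OF singular_chain_subdivision_power[OF assms]]
  by (induction N) auto

text \<open>After enough barycentric subdivisions every simplex lies in an open set whose labels
  form a blockwise proper set. Subdivision commutes with boundaries and rotations, so the label
  chains satisfy the hypotheses of \<open>dvd_augmentation\<close>. Then \<open>p\<close> divides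
  the augmentation of a single vertex, which is 1.\<close>

theorem no_blockwise_proper_labelling:
  fixes lab :: "(nat \<Rightarrow> real) \<Rightarrow> nat"
  assumes p: "prime p" and n: "n = t * (p - 1)"
  defines "X \<equiv> subtopology (powertop_real UNIV) (join_space p n)"
  assumes lab: "\<And>x. x \<in> join_space p n \<Longrightarrow> rot p (lab (reindex (rot p) x)) = lab x"
    and cover: "\<And>x. x \<in> join_space p n \<Longrightarrow> \<exists>U. openin X U \<and> x \<in> U \<and> blockwise_proper p t (lab ` U)"
  shows False
proof -
  have p0: "p > 0"
    using p prime_gt_0_nat by auto
  define \<C> where "\<C> = {U. openin X U \<and> blockwise_proper p t (lab ` U)}"
  have topX: "topspace X = join_space p n"
    by (simp add: X_def)
  have sing: "singular_chain k X (join_chain p k)" if "k \<le> n" for k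
    unfolding X_def
    using simplicial_imp_singular_chain[OF simplicial_join_chain[OF p0]] join_space_mono[OF that]
    by (rule singular_chain_mono)
  have "\<exists>N. \<forall>m\<ge>N. \<forall>f\<in>Poly_Mapping.keys ((singular_subdivision k ^^ m) (join_chain p k)).
      \<exists>V\<in>\<C>. f \<in> standard_simplex k \<rightarrow> V" if "k \<le> n" for k
  proof -
    have "topspace X \<subseteq> \<Union>\<C>"
      using cover unfolding topX \<C>_def by blast
    moreover have "openin X U" if "U \<in> \<C>" for U
      using that by (simp add: \<C>_def)
    ultimately show ?thesis
      using sufficient_iterated_singular_subdivision_exists[OF _ _ sing[OF that], of \<C>] by metis
  qed
  then obtain N where N: "\<And>k m f. k \<le> n \<Longrightarrow> m \<ge> N k \<Longrightarrow>
      f \<in> Poly_Mapping.keys ((singular_subdivision k ^^ m) (join_chain p k)) \<Longrightarrow>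
      \<exists>V\<in>\<C>. f \<in> standard_simplex k \<rightarrow> V"
    by metis
  \<comment> \<open>All degrees must be subdivided equally often, or the boundary relations between
    consecutive chains would be lost.\<close>
  define M where "M = Max (N ` {..n})"
  have M: "N k \<le> M" if "k \<le> n" for k
    using that by (simp add: M_def)
  define s where "s k = (singular_subdivision k ^^ M) (join_chain p k)" for k
  have s: "singular_chain k X (s k)" if "k \<le> n" for k
    unfolding s_def by (rule singular_chain_subdivision_power[OF sing[OF that]])
  have small: "\<exists>V. blockwise_proper p t (lab ` V) \<and> f ` standard_simplex k \<subseteq> V"
    if "k \<le> n" "f \<in> Poly_Mapping.keys (s k)" for k f
    using N[OF that(1) M[OF that(1)]] that(2) unfolding s_def \<C>_def by blast
  define a where "a k = label_chain lab k (s k)" for k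
  have supp: "blockwise_proper p t (set ts) \<and> length ts = Suc k" if k: "k \<le> n" and nz: "a k ts \<noteq> 0" for k ts
  proof -
    obtain f where f: "f \<in> Poly_Mapping.keys (s k)" "set ts \<subseteq> lab ` f ` standard_simplex k" "length ts = Suc k"
      using nz unfolding a_def by (elim label_chain_nonzeroE)
    obtain V where "blockwise_proper p t (lab ` V)" "f ` standard_simplex k \<subseteq> V"
      using small[OF k f(1)] by blast
    moreover have "set ts \<noteq> {}"
      using f(3) by auto
    ultimately show ?thesis
      using f blockwise_proper_subset by (metis image_mono order_trans)
  qed
  have alt: "alternating (a k)" for k
    unfolding a_def by (rule alternating_label_chain)
  have "int p dvd (\<Sum>v<t * p. a 0 [v])"
  proof (rule dvd_augmentation[OF p])
    show "block_chain p t (a k)" if "k \<le> n" for k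
      unfolding block_chain_def using alt supp[OF that] by blast
    show "bdry p t (a (Suc k)) = rot_op p k (a k)" if "k < n" for k
    proof
      fix ts
      have k: "k \<le> n" "Suc k \<le> n"
        using that by auto
      have "set (vertex_labels lab (Suc k) f) \<subseteq> {..<t * p}" if f: "f \<in> Poly_Mapping.keys (s (Suc k))" for f
      proof -
        obtain V where V: "blockwise_proper p t (lab ` V)" "f ` standard_simplex (Suc k) \<subseteq> V"
          using small[OF k(2) f] by blast
        then have "lab ` f ` standard_simplex (Suc k) \<subseteq> {..<t * p}"
          unfolding blockwise_proper_def by blast
        then show ?thesis
          using set_vertex_labels by (rule order_trans[rotated])
      qed
      then have "(\<Sum>v<t * p. a (Suc k) (v # ts)) = label_chain lab k (chain_boundary (Suc k) (s (Suc k))) ts"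
        unfolding a_def by (intro label_chain_boundary[symmetric]) auto
      also have "chain_boundary (Suc k) (s (Suc k)) = chain_op p k k (s k)"
        unfolding s_def chain_boundary_subdivision_power[OF sing[OF k(2)]] chain_boundary_join_chain[OF p0]
        by (rule subdivision_power_chain_op[OF sing[OF k(1)]])
      also have "label_chain lab k (chain_op p k k (s k)) = rot_op p k (a k)"
        unfolding a_def
        by (rule label_chain_chain_op[where n = n and lab = lab, OF p0 lab s[OF k(1), unfolded X_def]])
      finally have *: "(\<Sum>v<t * p. a (Suc k) (v # ts)) = rot_op p k (a k) ts" .
      have "a k [] = 0"
        using supp[OF k(1), of "[]"] by auto
      then show "bdry p t (a (Suc k)) ts = rot_op p k (a k) ts"
        using * by (cases "ts = []") (auto simp: bdry_def rot_op_def)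
    qed
    have "a n ts = 0" for ts
    proof (rule ccontr)
      assume nz: "a n ts \<noteq> 0"
      then have "distinct ts"
        using alternating_not_distinct[OF alt] by blast
      then have "card (set ts) = Suc n"
        using supp[OF _ nz] distinct_card by fastforce
      then show False
        using card_blockwise_proper supp[OF _ nz] n by fastforce
    qed
    then show "a n = (\<lambda>ts. 0)"
      by blast
  qed
  moreover have "(\<Sum>v<t * p. a 0 [v]) = 1"
  proof -
    \<comment> \<open>Subdivision leaves 0-chains fixed, so a single vertex remains.\<close>
    have "s 0 = join_chain p 0"
      unfolding s_def using singular_subdivision_zero[OF sing[of 0]] by (induction M) auto
    then have a0: "a 0 [v] = (if v = lab (unit_vec 0) then 1 else 0)" for v
      using unit_vec_in_standard_simplex[of 0 0]
      by (simp add: a_def label_chain_def vertex_labels_def alt_list_Cons alt_list_def)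
    have "unit_vec 0 \<in> join_space p 0"
      using p0 by (auto simp: join_space_def unit_vec_def)
    then have "unit_vec 0 \<in> join_space p n"
      using join_space_mono by blast
    then have "lab (unit_vec 0) < t * p"
      using cover[of "unit_vec 0"] unfolding blockwise_proper_def by blast
    then show ?thesis
      by (simp add: a0)
  qed
  ultimately show False
    using p prime_gt_1_nat by fastforce
qed

section \<open>Equivariant maps on the join\<close>

text \<open>A point is labelled by an equivariantly chosen coordinate at which \<open>u\<close> is maximal. Near \<open>x\<close> only
  coordinates that are maximal at \<open>x\<close> occur, and these cannot fill a block because the block sums vanish.\<close>

theorem equivariant_map_has_zero:
  fixes u :: "(nat \<Rightarrow> real) \<Rightarrow> nat \<Rightarrow> real"
  assumes p: "prime p" and t: "t \<ge> 1" and n: "n = t * (p - 1)"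
    and cont: "\<And>m. m < t * p \<Longrightarrow> continuous_on (join_space p n) (\<lambda>x. u x m)"
    and equiv: "\<And>x m. x \<in> join_space p n \<Longrightarrow> m < t * p \<Longrightarrow> u (reindex (rot p) x) m = u x (rot p m)"
    and block_sum: "\<And>x j. x \<in> join_space p n \<Longrightarrow> j < t \<Longrightarrow> (\<Sum>i<p. u x (j * p + i)) = 0"
  shows "\<exists>x\<in>join_space p n. \<forall>m<t * p. u x m = 0"
proof (rule ccontr)
  assume no_zero: "\<not> ?thesis"
  have p0: "p > 0"
    using p prime_gt_0_nat by auto
  let ?E = "join_space p n"
  define M where "M x = {m. m < t * p \<and> (\<forall>m'<t * p. u x m' \<le> u x m)}" for x
  have proper: "blockwise_proper p t (M x)" if x: "x \<in> ?E" for x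
  proof -
    have ne: "{..<t * p} \<noteq> {}"
      using t p0 by (simp add: lessThan_empty_iff)
    have "Max (u x ` {..<t * p}) \<in> u x ` {..<t * p}"
      using ne by (intro Max_in) auto
    then obtain m where m: "m < t * p" "u x m = Max (u x ` {..<t * p})"
      by auto
    then have "m \<in> M x"
      by (auto simp: M_def)
    moreover have "\<exists>i<p. j * p + i \<notin> M x" if j: "j < t" for j
    proof (rule ccontr)
      assume "\<not> (\<exists>i<p. j * p + i \<notin> M x)"
      \<comment> \<open>On a full block all values equal the global maximum, which is then 0 by the
        block sum. So all values are nonpositive, and the other block sums force them to be 0 as
        well.\<close>
      then have "j * p + i \<in> M x" if "i < p" for i
        using that by blast
      then have "u x (j * p + i) = u x m" if "i < p" for i
        using that \<open>m \<in> M x\<close> by (intro antisym) (auto simp: M_def)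
      then have "real p * u x m = 0"
        using block_sum[OF x j] by simp
      then have "u x m = 0"
        using p0 by simp
      then have nonpos: "u x m' \<le> 0" if "m' < t * p" for m'
        using \<open>m \<in> M x\<close> that by (auto simp: M_def)
      have "u x m' = 0" if m': "m' < t * p" for m'
      proof -
        have j': "m' div p < t"
          using m' p0 by (simp add: div_less_iff_less_mult)
        have "u x (m' div p * p + i) \<le> 0" if "i < p" for i
        proof (rule nonpos)
          have "(m' div p * p + i) div p < t"
            using j' that by simp
          then show "m' div p * p + i < t * p"
            using p0 div_less_iff_less_mult by blast
        qed
        then have "\<forall>i\<in>{..<p}. - u x (m' div p * p + i) = 0"
          using block_sum[OF x j'] by (subst sum_nonneg_eq_0_iff[symmetric]) (auto simp: sum_negf)
        then have "- u x (m' div p * p + m' mod p) = 0"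
          by (rule bspec) (use p0 in simp)
        then show ?thesis
          by simp
      qed
      then show False
        using no_zero x by blast
    qed
    ultimately show ?thesis
      by (auto simp: blockwise_proper_def M_def)
  qed
  have rotM: "rot p ` M (reindex (rot p) x) = M x" if x: "x \<in> ?E" for x
  proof -
    have im: "rot p ` {..<t * p} = {..<t * p}"
      using bij_betw_rot_lessThan[OF p0] by (simp add: bij_betw_def)
    have ball: "(\<forall>m'<t * p. P (rot p m')) \<longleftrightarrow> (\<forall>m'<t * p. P m')" for P
      using im by (metis (no_types, lifting) imageE image_eqI lessThan_iff)
    have "M (reindex (rot p) x) = {m. m < t * p \<and> rot p m \<in> M x}"
      using equiv[OF x] ball[of "\<lambda>m'. u x m' \<le> u x (rot p m)" for m] p0
      by (auto simp: M_def)
    moreover have "M x \<subseteq> {..<t * p}"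
      by (auto simp: M_def)
    ultimately show ?thesis
      using im by (auto simp: image_iff)
  qed
  obtain sel where sel: "\<And>S. blockwise_proper p t S \<Longrightarrow> sel S \<in> S"
    "\<And>S. blockwise_proper p t S \<Longrightarrow> sel (rot p ` S) = rot p (sel S)"
    using equivariant_selection_exists[OF p] by blast
  define lab where "lab x = sel (M x)" for x
  show False
  proof (rule no_blockwise_proper_labelling[OF p n, of lab])
    fix x assume x: "x \<in> ?E"
    show "rot p (lab (reindex (rot p) x)) = lab x"
      using sel(2)[OF proper[OF join_space_rot[OF p0 x]]] rotM[OF x] by (simp add: lab_def)
    have "\<exists>m'<t * p. u x m < u x m'" if "m \<in> {..<t * p} - M x" for m
      using that by (auto simp: M_def not_le)
    then obtain h where h: "\<And>m. m \<in> {..<t * p} - M x \<Longrightarrow> h m < t * p \<and> u x m < u x (h m)"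
      by metis
    \<comment> \<open>On \<open>W m\<close> the coordinate \<open>m\<close> is still beaten by
      \<open>h m\<close>; by continuity this strict inequality is an open condition.\<close>
    define W where "W m = ?E \<inter> (\<lambda>y. u y (h m) - u y m) -` {0<..}" for m
    define U where "U = (\<Inter>m\<in>{..<t * p} - M x. W m) \<inter> ?E"
    have "openin (top_of_set ?E) (W m)" if "m \<in> {..<t * p} - M x" for m
      unfolding W_def using h[OF that] that
      by (intro continuous_openin_preimage_gen continuous_on_diff cont) auto
    then have "openin (top_of_set ?E) U"
      using openin_INT[of "{..<t * p} - M x" "top_of_set ?E" W] by (simp add: U_def)
    moreover have "x \<in> U"
      using x h by (auto simp: U_def W_def)
    moreover have "lab ` U \<subseteq> M x"
    proof clarify
      fix y assume y: "y \<in> U"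
      then have "lab y \<in> M y"
        using sel(1)[OF proper] by (auto simp: U_def lab_def)
      show "lab y \<in> M x"
      proof (rule ccontr)
        assume "lab y \<notin> M x"
        then have *: "lab y \<in> {..<t * p} - M x"
          using \<open>lab y \<in> M y\<close> by (simp add: M_def)
        then have "y \<in> W (lab y)"
          using y unfolding U_def by blast
        then have "u y (lab y) < u y (h (lab y))"
          by (simp add: W_def)
        then show False
          using \<open>lab y \<in> M y\<close> h[OF *] by (force simp: M_def)
      qed
    qed
    ultimately show "\<exists>U. openin (subtopology (powertop_real UNIV) ?E) U \<and> x \<in> U \<and> blockwise_proper p t (lab ` U)"
      using blockwise_proper_subset[OF proper[OF x]] by (auto simp: euclidean_product_topology)
  qed
qed

section \<open>Dividing the interval\<close>

text \<open>A point of the join is read as a division: the \<open>l\<close>-th interval starts at \<open>level_start p x l\<close>, its length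
  is the total weight of the \<open>l\<close>-th copy, and it goes to the piece whose point carries that weight.\<close>

definition level_start :: "nat \<Rightarrow> (nat \<Rightarrow> real) \<Rightarrow> nat \<Rightarrow> real" where
  "level_start p x l = (\<Sum>m<l * p. x m)"

definition piece :: "nat \<Rightarrow> nat \<Rightarrow> (nat \<Rightarrow> real) \<Rightarrow> nat \<Rightarrow> real set" where
  "piece p n x i = (\<Union>l\<le>n. {level_start p x l ..< level_start p x l + x (l * p + i)})"

lemma level_start_Suc: "level_start p x (Suc l) = level_start p x l + (\<Sum>i<p. x (l * p + i))"
proof -
  have "(\<Sum>m<a + b. x m) = (\<Sum>m<a. x m) + (\<Sum>i<b. x (a + i))" for a b
    by (induction b) (auto simp: add.assoc)
  then show ?thesis
    by (simp add: level_start_def add.commute[of p])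
qed

lemma level_start_mono:
  assumes "x \<in> join_space p n" "l \<le> l'"
  shows "level_start p x l \<le> level_start p x l'"
  unfolding level_start_def using assms join_spaceD(1)[OF assms(1)]
  by (intro sum_mono2) (auto intro: order.strict_trans2 mult_right_mono)

lemma level_start_0 [simp]: "level_start p x 0 = 0"
  by (simp add: level_start_def)

lemma level_start_last: "x \<in> join_space p n \<Longrightarrow> level_start p x (Suc n) = 1"
  using join_spaceD(3) by (simp add: level_start_def)

lemma level_start_Suc_ge:
  assumes "x \<in> join_space p n" "i < p"
  shows "level_start p x l + x (l * p + i) \<le> level_start p x (Suc l)"
  unfolding level_start_Suc using member_le_sum[of i "{..<p}" "\<lambda>i. x (l * p + i)"] assms join_spaceD(1)
  by fastforce

lemma level_start_Suc_eq:
  assumes x: "x \<in> join_space p n" and i: "i < p" and nz: "x (l * p + i) \<noteq> 0"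
  shows "level_start p x (Suc l) = level_start p x l + x (l * p + i)"
proof -
  have "x (l * p + i') = 0" if "i' < p" "i' \<noteq> i" for i'
    using join_spaceD(4)[OF x nz, of "l * p + i'"] that i by fastforce
  then have "(\<Sum>i'<p. x (l * p + i')) = (\<Sum>i'\<in>{i}. x (l * p + i'))"
    using i by (intro sum.mono_neutral_right) auto
  then show ?thesis
    by (simp add: level_start_Suc)
qed

lemma piece_subset:
  assumes "x \<in> join_space p n" "i < p"
  shows "piece p n x i \<subseteq> {0..<1}"
proof -
  have "{level_start p x l ..< level_start p x l + x (l * p + i)} \<subseteq> {0..<1}" if "l \<le> n" for l
    using level_start_mono[OF assms(1), of 0 l] level_start_mono[OF assms(1), of "Suc l" "Suc n"]
      level_start_Suc_ge[OF assms, of l] level_start_last[OF assms(1)] that by auto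
  then show ?thesis
    unfolding piece_def by blast
qed

lemma piece_in_borel_01:
  assumes "x \<in> join_space p n" "i < p"
  shows "piece p n x i \<in> borel_01"
proof -
  have "piece p n x i \<in> sets borel"
    by (simp add: piece_def)
  moreover have "piece p n x i \<subseteq> {0..1}"
    using piece_subset[OF assms] by auto
  ultimately show ?thesis
    by (simp add: borel_01_def sets_restrict_space_iff)
qed

text \<open>Rotation moves weight only within a copy, so the intervals stay in place and only the
  pieces are renumbered.\<close>

lemma piece_reindex_rot:
  assumes "i < p"
  shows "piece p n (reindex (rot p) x) i = piece p n x (Suc i mod p)"
proof -
  have "level_start p (reindex (rot p) x) l = level_start p x l" for l
    unfolding level_start_def reindex_apply using assms by (intro sum_rot) auto
  then show ?thesis
    by (simp add: piece_def rot_block[OF assms])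
qed

section \<open>Continuous dependence of the pieces on the point\<close>

lemma measure_lambda_01_le:
  assumes "A \<in> sets borel" "A \<subseteq> {0..1}" "finite I" "A \<subseteq> (\<Union>i\<in>I. {a i..b i})" "\<And>i. i \<in> I \<Longrightarrow> a i \<le> b i"
  shows "measure lambda_01 A \<le> (\<Sum>i\<in>I. b i - a i)"
proof -
  have "measure lambda_01 A = measure lborel A"
    unfolding lambda_01_def using assms by (intro measure_restrict_space) auto
  also have "\<dots> \<le> measure lborel (\<Union>i\<in>I. {a i..b i})"
  proof (rule measure_mono_fmeasurable)
    show "(\<Union>i\<in>I. {a i..b i}) \<in> fmeasurable lborel"
      using assms(3) by (intro fmeasurable_compact compact_UN) auto
  qed (use assms in auto)
  also have "\<dots> \<le> (\<Sum>i\<in>I. measure lborel {a i..b i})"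
    using assms(3) by (intro measure_UNION_le) auto
  also have "\<dots> = (\<Sum>i\<in>I. b i - a i)"
    using assms(5) by (intro sum.cong) auto
  finally show ?thesis .
qed

text \<open>The total displacement of the two end points of all intervals: an upper bound for the
  measure of the symmetric difference that is visibly continuous.\<close>

definition piece_dist :: "nat \<Rightarrow> nat \<Rightarrow> nat \<Rightarrow> (nat \<Rightarrow> real) \<Rightarrow> (nat \<Rightarrow> real) \<Rightarrow> real" where
  "piece_dist p n i x y = (\<Sum>l\<le>n. \<bar>level_start p x l - level_start p y l\<bar>
     + \<bar>level_start p x l + x (l * p + i) - (level_start p y l + y (l * p + i))\<bar>)"

text \<open>A point in exactly one of the two pieces lies, for some \<open>l\<close>, in exactly one
  of the two intervals numbered \<open>l\<close>, hence between their left ends or between their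
  right ends.\<close>

lemma measure_piece_diff_le:
  assumes "x \<in> join_space p n" "y \<in> join_space p n" "i < p"
  shows "measure lambda_01 ((piece p n x i - piece p n y i) \<union> (piece p n y i - piece p n x i))
    \<le> piece_dist p n i x y"
proof -
  let ?D = "(piece p n x i - piece p n y i) \<union> (piece p n y i - piece p n x i)"
  define e where "e z l b = (if b then level_start p z l + z (l * p + i) else level_start p z l)"
    for z l and b :: bool
  define lo where "lo = (\<lambda>(l, b). min (e x l b) (e y l b))"
  define hi where "hi = (\<lambda>(l, b). max (e x l b) (e y l b))"
  let ?I = "{..n} \<times> (UNIV :: bool set)"
  have "?D \<subseteq> (\<Union>s\<in>?I. {lo s..hi s})"
  proof
    fix z assume "z \<in> ?D"
    then obtain l where l: "l \<le> n" "(z \<in> {e x l False..<e x l True}) \<noteq> (z \<in> {e y l False..<e y l True})"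
      unfolding piece_def e_def by auto
    then have "z \<in> {lo (l, False)..hi (l, False)} \<or> z \<in> {lo (l, True)..hi (l, True)}"
      by (auto simp: lo_def hi_def min_def max_def)
    then show "z \<in> (\<Union>s\<in>?I. {lo s..hi s})"
      using l(1) by blast
  qed
  moreover have "?D \<in> sets borel" "?D \<subseteq> {0..1}"
    using piece_in_borel_01[OF assms(1,3)] piece_in_borel_01[OF assms(2,3)]
    by (auto simp: borel_01_def sets_restrict_space_iff)
  ultimately have "measure lambda_01 ?D \<le> (\<Sum>s\<in>?I. hi s - lo s)"
    by (intro measure_lambda_01_le) (auto simp: lo_def hi_def)
  also have "\<dots> = (\<Sum>l\<le>n. \<Sum>b\<in>UNIV. hi (l, b) - lo (l, b))"
    by (simp add: sum.cartesian_product)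
  also have "\<dots> = piece_dist p n i x y"
    unfolding piece_dist_def
    by (intro sum.cong) (auto simp: UNIV_bool lo_def hi_def e_def min_def max_def)
  finally show ?thesis .
qed

lemma continuous_on_piece:
  assumes "symm_diff_continuous v" "i < p"
  shows "continuous_on (join_space p n) (\<lambda>x. v (piece p n x i))"
  unfolding continuous_on_def tendsto_iff
proof (intro ballI allI impI)
  fix x and e :: real assume x: "x \<in> join_space p n" and e: "e > 0"
  let ?F = "at x within join_space p n"
  \<comment> \<open>Half of \<open>e\<close> turns the non-strict bound of
    \<open>symm_diff_continuous\<close> into a strict one.\<close>
  obtain d where d: "d > 0" "\<And>A B. A \<in> borel_01 \<Longrightarrow> B \<in> borel_01 \<Longrightarrow>
      measure lambda_01 ((A - B) \<union> (B - A)) \<le> d \<Longrightarrow> \<bar>v A - v B\<bar> \<le> e / 2"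
    using assms(1) e unfolding symm_diff_continuous_def by (meson half_gt_zero)
  have "continuous_on (join_space p n) (\<lambda>y. y m)" for m
    by (rule continuous_on_subset[OF continuous_on_product_coordinates]) simp
  then have "continuous_on (join_space p n) (\<lambda>y. piece_dist p n i x y)"
    unfolding piece_dist_def level_start_def by (intro continuous_intros)
  then have "((\<lambda>y. piece_dist p n i x y) \<longlongrightarrow> piece_dist p n i x x) ?F"
    using x by (simp add: continuous_on_def)
  then have "((\<lambda>y. piece_dist p n i x y) \<longlongrightarrow> 0) ?F"
    by (simp add: piece_dist_def)
  then have "\<forall>\<^sub>F y in ?F. piece_dist p n i x y < d"
    using d(1) by (rule order_tendstoD)
  moreover have "\<forall>\<^sub>F y in ?F. y \<in> join_space p n"
    by (simp add: eventually_at_filter)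
  ultimately show "\<forall>\<^sub>F y in ?F. dist (v (piece p n y i)) (v (piece p n x i)) < e"
  proof eventually_elim
    case (elim y)
    then have "\<bar>v (piece p n x i) - v (piece p n y i)\<bar> \<le> e / 2"
      using measure_piece_diff_le[OF x elim(2) assms(2)] piece_in_borel_01 x assms(2) by (intro d(2)) auto
    then show ?case
      using e by (simp add: dist_real_def abs_minus_commute)
  qed
qed

section \<open>From a point of the join to a partition by cuts\<close>

text \<open>The outer end points 0 and 1 impose no condition on \<open>y\<close>, since the last
  interval is closed.\<close>

lemma cut_interval_iff:
  assumes "sorted_wrt (<) xs" "set xs \<subseteq> {0..1}" "k \<le> length xs" "y \<in> {0..1}"
  shows "y \<in> cut_interval xs k \<longleftrightarrow> (k = 0 \<or> xs ! (k - 1) \<le> y) \<and> (k = length xs \<or> y < xs ! k)"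
  using assms by (auto simp: cut_interval_def Let_def nth_append nth_Cons')

lemma cut_interval_subset:
  assumes "set xs \<subseteq> {0..1}" "k \<le> length xs"
  shows "cut_interval xs k \<subseteq> {0..1}"
proof -
  have "(0 # xs @ [1]) ! i \<in> {0..1}" if "i < length xs + 2" for i
    using that assms(1) nth_mem[of i "0 # xs @ [1]"] by fastforce
  from this[of k] this[of "Suc k"] show ?thesis
    using assms(2) by (auto simp: cut_interval_def Let_def)
qed

lemma ex1_cut_interval:
  assumes xs: "sorted_wrt (<) xs" "set xs \<subseteq> {0..1}" and y: "y \<in> {0..1}"
  shows "\<exists>!k. k \<le> length xs \<and> y \<in> cut_interval xs k"
proof -
  \<comment> \<open>The interval sought is the one that ends at the first cut point above
    \<open>y\<close>, or the last interval if there is none.\<close>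
  define k where "k = (LEAST k. k = length xs \<or> y < xs ! k)"
  have k: "k = length xs \<or> y < xs ! k"
    unfolding k_def by (rule LeastI[of _ "length xs"]) simp
  have k_le: "k \<le> length xs"
    unfolding k_def by (rule Least_le) simp
  have "xs ! (k - 1) \<le> y" if "k \<noteq> 0"
    using not_less_Least[of "k - 1" "\<lambda>k. k = length xs \<or> y < xs ! k"] that
    unfolding k_def[symmetric] by auto
  then have "y \<in> cut_interval xs k"
    using k cut_interval_iff[OF xs k_le y] by auto
  moreover have "k' = k" if "k' \<le> length xs" "y \<in> cut_interval xs k'" for k'
  proof -
    have le: "xs ! i \<le> xs ! j" if "i \<le> j" "j < length xs" for i j
      using that sorted_wrt_nth_less[OF xs(1), of i j] by (cases "i = j") auto
    have False if ab: "a < b" "b \<le> length xs" "y \<in> cut_interval xs a" "y \<in> cut_interval xs b" for a b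
    proof -
      have "y < xs ! a" "xs ! (b - 1) \<le> y"
        using ab cut_interval_iff[OF xs _ y, of a] cut_interval_iff[OF xs _ y, of b] by auto
      then show False
        using le[of a "b - 1"] ab by linarith
    qed
    then show ?thesis
      using that k_le \<open>y \<in> cut_interval xs k\<close> by (meson nat_neq_iff)
  qed
  ultimately show ?thesis
    using k_le by blast
qed

text \<open>The cuts are the starts of the copies 1 to \<open>n\<close>. Coinciding starts give one
  cut, so every cut interval has to find its copy again. The pieces are half-open and miss the point
  1, which the partition must cover.\<close>

lemma partition_from_join_point:
  assumes x: "x \<in> join_space p n" and p: "p > 0"
  obtains A where "partition_using_cuts n p A"
    "\<And>i. i \<in> {1..p} \<Longrightarrow> A i \<in> borel_01"
    "\<And>i. i \<in> {1..p} \<Longrightarrow> (A i - piece p n x (i - 1)) \<union> (piece p n x (i - 1) - A i) \<subseteq> {1}"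
proof -
  let ?T = "level_start p x"
  define xs where "xs = sorted_list_of_set (?T ` {1..n})"
  define ys where "ys = 0 # xs @ [1]"
  \<comment> \<open>Of several copies with the same start all but the last have length 0, hence the
    maximum.\<close>
  define lev where "lev k = Max {l. l \<le> n \<and> ?T l \<le> ys ! k}" for k
  \<comment> \<open>The default 0 keeps \<open>f\<close> within \<open>{1..p}\<close> for a copy
    without weight.\<close>
  define col where "col l = (if \<exists>i<p. x (l * p + i) \<noteq> 0 then (SOME i. i < p \<and> x (l * p + i) \<noteq> 0) else 0)" for l
  define f where "f k = Suc (col (lev k))" for k
  define A where "A i = (\<Union>k\<in>{k. k \<le> length xs \<and> f k = i}. cut_interval xs k)" for i
  have T01: "?T l \<in> {0..1}" if "l \<le> Suc n" for l
    using level_start_mono[OF x, of 0 l] level_start_mono[OF x, of l "Suc n"] level_start_last[OF x] that by auto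
  have set_xs: "set xs = ?T ` {1..n}"
    by (simp add: xs_def)
  have xs: "sorted_wrt (<) xs" "set xs \<subseteq> {0..1}"
    using T01 by (auto simp: set_xs) (simp add: xs_def)
  have len: "length xs \<le> n"
    unfolding xs_def length_sorted_list_of_set using card_image_le[of "{1..n}" ?T] by simp
  have col_SOME: "col l < p \<and> x (l * p + col l) \<noteq> 0" if "i < p" "x (l * p + i) \<noteq> 0" for l i
  proof -
    have "\<exists>i. i < p \<and> x (l * p + i) \<noteq> 0"
      using that by blast
    from someI_ex[OF this] show ?thesis
      using that by (auto simp: col_def)
  qed
  have col_eq: "col l = i" if "i < p" "x (l * p + i) \<noteq> 0" for l i
  proof -
    have c: "col l < p" "x (l * p + col l) \<noteq> 0"
      using col_SOME[OF that] by auto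
    show ?thesis
      using join_spaceD(4)[OF x c(2) that(2)] c(1) that(1) by simp
  qed
  have col_lt: "col l < p" for l
    using col_SOME[of _ l] p by (cases "\<exists>i<p. x (l * p + i) \<noteq> 0") (auto simp: col_def)
  \<comment> \<open>The start of the next copy is itself a cut, and by maximality of
    \<open>lev k\<close> not an earlier one, so the cut interval does not leave the copy. The point
    1 lies beyond every half-open interval.\<close>
  have in_level: "?T (lev k) \<le> y \<and> y < ?T (Suc (lev k)) \<and> lev k \<le> n"
    if k: "k \<le> length xs" and y: "y \<in> cut_interval xs k" "y < 1" for k y
  proof -
    have y01: "y \<in> {0..1}"
      using cut_interval_subset[OF xs(2) k] y by blast
    have ysk: "ys ! k = (if k = 0 then 0 else xs ! (k - 1))"
      using k by (auto simp: ys_def nth_Cons' nth_append)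
    have yk: "ys ! k \<le> y" "k = length xs \<or> y < xs ! k"
      using cut_interval_iff[OF xs k y01] y(1) y01 unfolding ysk by auto
    have "0 \<le> ys ! k"
      unfolding ysk using xs(2) k nth_mem[of "k - 1" xs] by (cases k) (auto simp: subset_iff)
    then have "0 \<in> {l. l \<le> n \<and> ?T l \<le> ys ! k}"
      by simp
    then have lev: "lev k \<in> {l. l \<le> n \<and> ?T l \<le> ys ! k}"
      unfolding lev_def by (intro Max_in) auto
    have "y < ?T (Suc (lev k))"
    proof (cases "lev k = n")
      case True
      then show ?thesis
        using level_start_last[OF x] y by simp
    next
      case False
      then have le: "Suc (lev k) \<le> n"
        using lev by simp
      have gt: "ys ! k < ?T (Suc (lev k))"
      proof (rule ccontr)
        assume "\<not> ys ! k < ?T (Suc (lev k))"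
        then have "Suc (lev k) \<in> {l. l \<le> n \<and> ?T l \<le> ys ! k}"
          using le by simp
        then have "Suc (lev k) \<le> lev k"
          unfolding lev_def by (intro Max_ge) auto
        then show False
          by simp
      qed
      have "?T (Suc (lev k)) \<in> set xs"
        using le by (auto simp: set_xs)
      then obtain j where j: "j < length xs" "xs ! j = ?T (Suc (lev k))"
        by (auto simp: in_set_conv_nth)
      have mono: "xs ! a \<le> xs ! b" if "a \<le> b" "b < length xs" for a b
        using that sorted_wrt_nth_less[OF xs(1), of a b] by (cases "a = b") auto
      show ?thesis
      proof (cases "k \<le> j")
        case True
        then have "y < xs ! k" "xs ! k \<le> xs ! j"
          using yk(2) True j(1) mono[OF True j(1)] by auto
        then show ?thesis
          using j by simp
      next
        case False
        then have "xs ! j \<le> ys ! k"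
          using mono[of j "k - 1"] k unfolding ysk by auto
        then show ?thesis
          using gt j by simp
      qed
    qed
    then show ?thesis
      using lev yk by auto
  qed
  have same_level: "l = l'" if "?T l \<le> y" "y < ?T (Suc l)" "?T l' \<le> y" "y < ?T (Suc l')" for l l' y
  proof (rule ccontr)
    assume "l \<noteq> l'"
    then have "Suc l \<le> l' \<or> Suc l' \<le> l"
      by auto
    then show False
      using level_start_mono[OF x, of "Suc l" l'] level_start_mono[OF x, of "Suc l'" l] that by auto
  qed
  have A_sub: "A i \<subseteq> {0..1}" for i
    using cut_interval_subset[OF xs(2)] by (auto simp: A_def)
  have f_range: "f k \<in> {1..p}" for k
    using col_lt by (simp add: f_def Suc_le_eq)
  show thesis
  proof
    have "\<exists>i\<in>{1..p}. y \<in> A i" if "y \<in> {0..1}" for y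
    proof -
      obtain k where "k \<le> length xs" "y \<in> cut_interval xs k"
        using ex1_cut_interval[OF xs \<open>y \<in> {0..1}\<close>] by blast
      then show ?thesis
        using f_range[of k] by (intro bexI[of _ "f k"]) (auto simp: A_def)
    qed
    then have "(\<Union>i\<in>{1..p}. A i) = {0..1}"
      using A_sub by blast
    moreover have "disjoint_family_on A {1..p}"
      unfolding disjoint_family_on_def
    proof (intro ballI impI)
      fix i j :: nat assume "i \<noteq> j"
      show "A i \<inter> A j = {}"
      proof (rule ccontr)
        assume "A i \<inter> A j \<noteq> {}"
        then obtain y where y: "y \<in> A i" "y \<in> A j"
          by blast
        then show False
          using ex1_cut_interval[OF xs, of y] A_sub[of i] \<open>i \<noteq> j\<close> unfolding A_def by blast
      qed
    qed
    ultimately show "partition_using_cuts n p A"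
      unfolding partition_using_cuts_def
      using xs len f_range by (intro conjI exI[of _ xs] exI[of _ f]) (auto simp: A_def)
    fix i assume i: "i \<in> {1..p}"
    have "cut_interval xs k \<in> sets borel" for k
      by (simp add: cut_interval_def Let_def)
    then have "A i \<in> sets borel"
      unfolding A_def by (intro sets.finite_UN) auto
    then show "A i \<in> borel_01"
      using A_sub by (simp add: borel_01_def sets_restrict_space_iff)
    have "y \<in> A i \<longleftrightarrow> y \<in> piece p n x (i - 1)" if y: "y \<in> {0..<1}" for y
    proof -
      have y01: "y \<in> {0..1}"
        using y by simp
      obtain k where k: "k \<le> length xs" "y \<in> cut_interval xs k"
        using ex1_cut_interval[OF xs y01] by blast
      have uniq: "k' = k" if "k' \<le> length xs" "y \<in> cut_interval xs k'" for k'
        using ex1_cut_interval[OF xs y01] k that by blast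
      have lev: "?T (lev k) \<le> y" "y < ?T (Suc (lev k))" "lev k \<le> n"
        using in_level[OF k] y by auto
      have A_iff: "y \<in> A i \<longleftrightarrow> col (lev k) = i - 1"
      proof -
        have "y \<in> A i \<longleftrightarrow> f k = i"
          using k uniq unfolding A_def by blast
        then show ?thesis
          using i by (auto simp: f_def)
      qed
      have "\<exists>i<p. x (lev k * p + i) \<noteq> 0"
      proof (rule ccontr)
        assume "\<not> ?thesis"
        then show False
          using lev by (simp add: level_start_Suc)
      qed
      then have nz: "x (lev k * p + col (lev k)) \<noteq> 0"
        using col_SOME by blast
      show ?thesis
      proof
        assume "y \<in> A i"
        then have "y < ?T (lev k) + x (lev k * p + (i - 1))"
          using level_start_Suc_eq[OF x col_lt nz] lev A_iff by simp
        then show "y \<in> piece p n x (i - 1)"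
          using lev by (auto simp: piece_def)
      next
        assume "y \<in> piece p n x (i - 1)"
        then obtain l where l: "l \<le> n" "?T l \<le> y" "y < ?T l + x (l * p + (i - 1))"
          by (auto simp: piece_def)
        have i': "i - 1 < p"
          using i by auto
        have nz': "x (l * p + (i - 1)) \<noteq> 0"
          using l by auto
        have "y < ?T (Suc l)"
          using level_start_Suc_eq[OF x i' nz'] l by simp
        then have "l = lev k"
          using same_level l lev by blast
        then show "y \<in> A i"
          using A_iff col_eq[OF i' nz'] by simp
      qed
    qed
    moreover have "piece p n x (i - 1) \<subseteq> {0..<1}"
      using i by (intro piece_subset[OF x]) auto
    ultimately show "(A i - piece p n x (i - 1)) \<union> (piece p n x (i - 1) - A i) \<subseteq> {1}"
      using A_sub[of i] by fastforce
  qed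
qed

text \<open>A difference of measure 0 is below every \<delta>, so the values differ by at most every
  \<epsilon>. This absorbs the disagreement at the point 1.\<close>

lemma symm_diff_continuous_null:
  assumes v: "symm_diff_continuous v" and AB: "A \<in> borel_01" "B \<in> borel_01"
    and sub: "(A - B) \<union> (B - A) \<subseteq> {c}" 
  shows "v A = v B"
proof -
  have "(A - B) \<union> (B - A) \<in> sets borel" "(A - B) \<union> (B - A) \<subseteq> {0..1}"
    using AB by (auto simp: borel_01_def sets_restrict_space_iff)
  then have "measure lambda_01 ((A - B) \<union> (B - A)) \<le> (\<Sum>i\<in>{()}. c - c)"
    using sub by (intro measure_lambda_01_le) auto
  then have le: "measure lambda_01 ((A - B) \<union> (B - A)) \<le> 0"
    by simp
  have "\<bar>v A - v B\<bar> \<le> 0 + e" if "e > 0" for e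
    using v AB le that unfolding symm_diff_continuous_def by (metis add_0 le_less_trans less_imp_le)
  then have "\<bar>v A - v B\<bar> \<le> 0"
    by (rule field_le_epsilon)
  then show ?thesis
    by simp
qed

theorem mainTheorem19:
  fixes p t :: nat and v :: "nat \<Rightarrow> real set \<Rightarrow> real"
  assumes "prime p" and "t \<ge> 1"
    and "\<And>j. j \<in> {1..t} \<Longrightarrow> symm_diff_continuous (v j)"
  shows "\<exists>A. partition_using_cuts ((p - 1) * t) p A \<and>
           (\<forall>i\<in>{1..p}. \<forall>l\<in>{1..p}. \<forall>j\<in>{1..t}. v j (A i) = v j (A l))"
proof -
  define n where "n = t * (p - 1)"
  have p: "p > 0"
    using assms(1) prime_gt_0_nat by auto
  \<comment> \<open>Functions and pieces are numbered from 0 here, as blocks and positions are.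
    Subtracting the mean makes the block sums vanish, and a zero of \<open>u\<close> gives every
    piece the same value.\<close>
  define w where "w x j i = v (Suc j) (piece p n x i)" for x j i
  define avg where "avg x j = (\<Sum>i<p. w x j i) / real p" for x j
  define u where "u x m = w x (m div p) (m mod p) - avg x (m div p)" for x m
  have div_less: "m div p < t" if "m < t * p" for m
    using that p by (simp add: div_less_iff_less_mult)
  have cont_w: "continuous_on (join_space p n) (\<lambda>x. w x j i)" if "j < t" "i < p" for j i
    unfolding w_def using assms(3)[of "Suc j"] that by (intro continuous_on_piece) auto
  have w_rot: "w (reindex (rot p) x) j i = w x j (rot p i)" if "i < p" for x j i
    using that piece_reindex_rot[OF that] by (simp add: w_def rot_def)
  have "\<exists>x\<in>join_space p n. \<forall>m<t * p. u x m = 0"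
  proof (rule equivariant_map_has_zero[OF assms(1,2) n_def])
    fix m assume "m < t * p"
    then show "continuous_on (join_space p n) (\<lambda>x. u x m)"
      unfolding u_def avg_def using div_less p by (intro continuous_intros cont_w) auto
  next
    fix x m
    have "avg (reindex (rot p) x) j = avg x j" for j
      using sum_rot[OF p, where k = 1 and f = "w x j"] by (simp add: avg_def w_rot)
    moreover have "rot p (m mod p) = rot p m mod p"
      using p by (simp add: rot_def)
    ultimately show "u (reindex (rot p) x) m = u x (rot p m)"
      using p by (simp add: u_def w_rot)
  next
    fix x j
    show "(\<Sum>i<p. u x (j * p + i)) = 0"
      using p by (simp add: u_def sum_subtractf) (simp add: avg_def)
  qed
  then obtain x where x: "x \<in> join_space p n" and zero: "\<And>m. m < t * p \<Longrightarrow> u x m = 0"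
    by blast
  have w_avg: "w x j i = avg x j" if "j < t" "i < p" for j i
  proof -
    have "(j * p + i) div p < t"
      using that by simp
    then have "j * p + i < t * p"
      using p div_less_iff_less_mult by blast
    then show ?thesis
      using zero[of "j * p + i"] that by (simp add: u_def)
  qed
  obtain A where A: "partition_using_cuts n p A" "\<And>i. i \<in> {1..p} \<Longrightarrow> A i \<in> borel_01"
    "\<And>i. i \<in> {1..p} \<Longrightarrow> (A i - piece p n x (i - 1)) \<union> (piece p n x (i - 1) - A i) \<subseteq> {1}"
    using partition_from_join_point[OF x p] by blast
  \<comment> \<open>The value does not depend on \<open>i\<close>, which is the required
    equality.\<close>
  have "v j (A i) = avg x (j - 1)" if "i \<in> {1..p}" "j \<in> {1..t}" for i j
  proof -
    have i: "i - 1 < p" and j: "j - 1 < t" "Suc (j - 1) = j"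
      using that by auto
    have "v j (A i) = v j (piece p n x (i - 1))"
      using symm_diff_continuous_null[OF assms(3)[OF that(2)] A(2)[OF that(1)] piece_in_borel_01[OF x i]]
        A(3)[OF that(1)] by blast
    also have "\<dots> = w x (j - 1) (i - 1)"
      using j by (simp add: w_def)
    finally show ?thesis
      using w_avg[OF j(1) i] by simp
  qed
  then show ?thesis
    using A(1) by (intro exI[of _ A]) (simp add: n_def mult.commute)
qed

end
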